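(* Let $j$ be a positive integer. There is a linear-time algorithm which, given a ditree $T$, decides whether or not $\vec{\lambda}_{j}(T) = j+1$ (with no assumption on the length of the longest dipath in $T$). In particular, there is a linear-time algorithm that determines $\vec{\lambda}_j(T)$ for every ditree $T$ whose longest dipath is of length $3$.
   Context: A ditree is an orientation of a finite tree, i.e. a digraph obtained from a tree by assigning one direction to each edge. In a digraph $D$, $xy\in E(D)$ denotes an edge directed from $x$ to $y$. A dipath of length $\ell$ is a sequence of $\ell+1$ distinct vertices $v_0,v_1,\dots,v_\ell$ with $v_iv_{i+1}\in E(D)$ for all $0\le i<\ell$. The distance $d_D(x,y)$ is the length of a shortest dipath from $x$ to $y$ (if one exists). For a positive integer $j$, an $L(j,1)$-labeling of $D$ is a function $f$ from $V(D)$ to the nonnegative integers such that $|f(x)-f(y)|\ge j$ whenever $xy\in E(D)$ and $|f(x)-f(y)|\ge 1$ whenever $d_D(x,y)=2$. The number $\vec{\lambda}_{j}(D)=\vec{\lambda}_{j,1}(D)$ is the minimum, over all $L(j,1)$-labelings $f$ of $D$, of the span of $f$ (largest label minus smallest label). Equivalently, it is the minimum over all $L(j,1)$-labelings of the maximum label used. "Linear-time" means that the number of elementary operations is $O(|V(T)|)$. *)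

theory Defs
  imports
    "Graph_Theory.Digraph_Component"
    "Graph_Theory.Vertex_Walk"
    "HOL-Library.Extended_Nat"
begin

section \<open>Ditrees and $L(j,1)$-labelings\<close>

text \<open>
  Digraphs are those of Graph_Theory whose arcs are pairs of vertices. The predicates \<open>tree\<close> and
  \<open>forest\<close> of that library only exclude \<^emph>\<open>directed\<close> cycles, and count going back and forth along
  an edge as a cycle, so they do not describe orientations of undirected trees. Here a cycle of the
  underlying graph is a path on at least three vertices whose ends are adjacent. The conjunct
  \<open>connected\<close> includes that there is at least one vertex; the asymmetry of the arc set (which
  excludes loops) says that every edge receives exactly one direction.
\<close>

definition underlying_cycle :: "'a pair_pre_digraph \<Rightarrow> 'a list \<Rightarrow> bool" where
  "underlying_cycle D p \<longleftrightarrow>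
     vpath p (with_proj (mk_symmetric (with_proj D))) \<and> 3 \<le> length p \<and>
     (last p, hd p) \<in> parcs (mk_symmetric (with_proj D))"

definition ditree :: "'a pair_pre_digraph \<Rightarrow> bool" where
  "ditree D \<longleftrightarrow>
     pair_fin_digraph D \<and>
     (\<forall>x y. (x, y) \<in> parcs D \<longrightarrow> (y, x) \<notin> parcs D) \<and>
     Digraph_Component.connected (with_proj D) \<and>
     (\<nexists>p. underlying_cycle D p)"

abbreviation dipath :: "'a pair_pre_digraph \<Rightarrow> 'a list \<Rightarrow> bool" where
  "dipath D p \<equiv> vpath p (with_proj D)"

definition longest_dipath_length :: "'a pair_pre_digraph \<Rightarrow> nat \<Rightarrow> bool" where
  "longest_dipath_length D l \<longleftrightarrow>
     (\<exists>p. dipath D p \<and> vwalk_length p = l) \<and> (\<forall>p. dipath D p \<longrightarrow> vwalk_length p \<le> l)"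

text \<open>The distance is \<open>\<infinity>\<close> if there is no dipath from \<open>x\<close> to \<open>y\<close>.\<close>

definition ddist :: "'a pair_pre_digraph \<Rightarrow> 'a \<Rightarrow> 'a \<Rightarrow> enat" where
  "ddist D x y = (INF p \<in> {p. dipath D p \<and> hd p = x \<and> last p = y}. enat (vwalk_length p))"

definition L_labeling :: "nat \<Rightarrow> 'a pair_pre_digraph \<Rightarrow> ('a \<Rightarrow> nat) \<Rightarrow> bool" where
  "L_labeling j D f \<longleftrightarrow>
     (\<forall>x \<in> pverts D. \<forall>y \<in> pverts D.
        ((x, y) \<in> parcs D \<longrightarrow> \<bar>int (f x) - int (f y)\<bar> \<ge> int j) \<and>
        (ddist D x y = 2 \<longrightarrow> \<bar>int (f x) - int (f y)\<bar> \<ge> 1))"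

definition label_span :: "'a pair_pre_digraph \<Rightarrow> ('a \<Rightarrow> nat) \<Rightarrow> nat" where
  "label_span D f = Max (f ` pverts D) - Min (f ` pverts D)"

definition dilambda :: "nat \<Rightarrow> 'a pair_pre_digraph \<Rightarrow> nat" where
  "dilambda j D = (LEAST k. \<exists>f. L_labeling j D f \<and> label_span D f = k)"


section \<open>A unit-cost word RAM\<close>

text \<open>
  Algorithms are structured programs over a random-access memory that consists of finitely many
  arrays of natural numbers (those named in the program); a scalar variable is cell 0 of an array.
  Every elementary operation (constant, memory access, arithmetic operation, comparison, assignment,
  branch) costs one unit. To keep unit costs honest, the semantics has a parameter \<open>W\<close>, the largest
  number that fits into a memory word: execution is stuck as soon as an address or the value of
  any subexpression exceeds \<open>W\<close>.
\<close>

datatype binop = Plus | Minus | Times | Div | Mod | Less | Equal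

datatype exp =
    Const nat
  | Read string exp
  | Op binop exp exp

datatype com =
    Skip
  | Write string exp exp  \<comment> \<open>array, index, new value\<close>
  | Seq com com
  | Cond exp com com      \<comment> \<open>a condition is true iff its value is not 0\<close>
  | While exp com

type_synonym store = "string \<Rightarrow> nat \<Rightarrow> nat"

fun apply_op :: "binop \<Rightarrow> nat \<Rightarrow> nat \<Rightarrow> nat" where
  "apply_op Plus x y = x + y"
| "apply_op Minus x y = x - y"
| "apply_op Times x y = x * y"
| "apply_op Div x y = x div y"
| "apply_op Mod x y = x mod y"
| "apply_op Less x y = of_bool (x < y)"
| "apply_op Equal x y = of_bool (x = y)"

fun eval :: "store \<Rightarrow> exp \<Rightarrow> nat" where
  "eval s (Const k) = k"
| "eval s (Read a e) = s a (eval s e)"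
| "eval s (Op b e1 e2) = apply_op b (eval s e1) (eval s e2)"

fun fits :: "nat \<Rightarrow> store \<Rightarrow> exp \<Rightarrow> bool" where
  "fits W s (Const k) \<longleftrightarrow> k \<le> W"
| "fits W s (Read a e) \<longleftrightarrow> fits W s e \<and> eval s (Read a e) \<le> W"
| "fits W s (Op b e1 e2) \<longleftrightarrow> fits W s e1 \<and> fits W s e2 \<and> eval s (Op b e1 e2) \<le> W"

fun cost :: "exp \<Rightarrow> nat" where
  "cost (Const k) = 1"
| "cost (Read a e) = cost e + 1"
| "cost (Op b e1 e2) = cost e1 + cost e2 + 1"

text \<open>\<open>exec W c s t s'\<close>: started in \<open>s\<close>, program \<open>c\<close> halts in \<open>s'\<close> after \<open>t\<close> elementary operations.\<close>

inductive exec :: "nat \<Rightarrow> com \<Rightarrow> store \<Rightarrow> nat \<Rightarrow> store \<Rightarrow> bool" for W where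
  Skip: "exec W Skip s 1 s"
| Write: "fits W s i \<Longrightarrow> fits W s e \<Longrightarrow>
    exec W (Write a i e) s (cost i + cost e + 1) (s(a := (s a)(eval s i := eval s e)))"
| Seq: "exec W c1 s t1 s1 \<Longrightarrow> exec W c2 s1 t2 s2 \<Longrightarrow> exec W (Seq c1 c2) s (t1 + t2) s2"
| CondTrue: "fits W s b \<Longrightarrow> eval s b \<noteq> 0 \<Longrightarrow> exec W c1 s t s' \<Longrightarrow>
    exec W (Cond b c1 c2) s (cost b + 1 + t) s'"
| CondFalse: "fits W s b \<Longrightarrow> eval s b = 0 \<Longrightarrow> exec W c2 s t s' \<Longrightarrow>
    exec W (Cond b c1 c2) s (cost b + 1 + t) s'"
| WhileTrue: "fits W s b \<Longrightarrow> eval s b \<noteq> 0 \<Longrightarrow> exec W c s t1 s1 \<Longrightarrow>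
    exec W (While b c) s1 t2 s2 \<Longrightarrow> exec W (While b c) s (cost b + 1 + t1 + t2) s2"
| WhileFalse: "fits W s b \<Longrightarrow> eval s b = 0 \<Longrightarrow> exec W (While b c) s (cost b + 1) s"

inductive_cases exec_SkipE: "exec W Skip s t s'"
inductive_cases exec_WriteE: "exec W (Write a i e) s t s'"
inductive_cases exec_SeqE: "exec W (Seq c1 c2) s t s'"
inductive_cases exec_CondE: "exec W (Cond b c1 c2) s t s'"
inductive_cases exec_WhileE: "exec W (While b c) s t s'"

lemma exec_deterministic:
  "exec W c s t s' \<Longrightarrow> exec W c s u s'' \<Longrightarrow> u = t \<and> s'' = s'"
proof (induction arbitrary: u s'' rule: exec.induct)
  case (Seq c1 s t1 s1 c2 t2 s2)
  from Seq.prems obtain u1 u2 r where u: "u = u1 + u2"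
    and r: "exec W c1 s u1 r" "exec W c2 r u2 s''"
    by (elim exec_SeqE)
  from r(1) have "u1 = t1 \<and> r = s1" by (rule Seq.IH(1))
  moreover from this r(2) have "u2 = t2 \<and> s'' = s2" by (intro Seq.IH(2)) simp
  ultimately show ?case using u by simp
next
  case (CondTrue s b c1 t s' c2)
  from CondTrue.prems CondTrue.hyps(2) obtain u1 where "u = cost b + 1 + u1" "exec W c1 s u1 s''"
    by (elim exec_CondE) auto
  with CondTrue.IH show ?case by blast
next
  case (CondFalse s b c2 t s' c1)
  from CondFalse.prems CondFalse.hyps(2) obtain u1 where "u = cost b + 1 + u1" "exec W c2 s u1 s''"
    by (elim exec_CondE) auto
  with CondFalse.IH show ?case by blast
next
  case (WhileTrue s b c t1 s1 t2 s2)
  obtain u1 u2 r where u: "u = cost b + 1 + u1 + u2"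
    and r: "exec W c s u1 r" "exec W (While b c) r u2 s''"
    by (rule exec_WhileE[OF WhileTrue.prems]) (use WhileTrue.hyps(2) in auto)
  from r(1) have "u1 = t1 \<and> r = s1" by (rule WhileTrue.IH(1))
  moreover from this r(2) have "u2 = t2 \<and> s'' = s2" by (intro WhileTrue.IH(2)) simp
  ultimately show ?case using u by simp
next
  case (WhileFalse s b c)
  show ?case by (rule exec_WhileE[OF WhileFalse.prems]) (use WhileFalse.hyps(2) in auto)
qed (auto elim: exec_SkipE exec_WriteE)


section \<open>Linear-time algorithms on digraphs\<close>

text \<open>
  The input digraph has vertices \<open>0, \<dots>, n - 1\<close> and is given by \<open>n\<close>, the number of arcs and
  the list of its arcs, in any order; all other cells are initially 0.
\<close>

definition arc_list_of :: "nat pair_pre_digraph \<Rightarrow> (nat \<times> nat) list \<Rightarrow> bool" where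
  "arc_list_of D es \<longleftrightarrow>
     pverts D = {..<card (pverts D)} \<and> distinct es \<and> set es = parcs D"

definition input_store :: "nat pair_pre_digraph \<Rightarrow> (nat \<times> nat) list \<Rightarrow> store" where
  "input_store D es = (\<lambda>a i.
     if a = ''n'' \<and> i = 0 then card (pverts D)
     else if a = ''m'' \<and> i = 0 then length es
     else if a = ''tail'' \<and> i < length es then fst (es ! i)
     else if a = ''head'' \<and> i < length es then snd (es ! i)
     else 0)"

text \<open>
  On every input digraph satisfying \<open>Inst\<close>, the program writes \<open>F D\<close> into cell 0 of the array
  \<open>out\<close>, within at most \<open>C * n\<close> elementary operations on numbers of at most \<open>d * log\<^sub>2 (n + 1)\<close> bits,
  where \<open>n\<close> is the number of vertices. Nothing is required on other inputs.
\<close>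

definition computes_in_linear_time ::
  "com \<Rightarrow> (nat pair_pre_digraph \<Rightarrow> bool) \<Rightarrow> (nat pair_pre_digraph \<Rightarrow> nat) \<Rightarrow> bool" where
  "computes_in_linear_time P Inst F \<longleftrightarrow>
     (\<exists>C d. \<forall>D es. Inst D \<and> arc_list_of D es \<longrightarrow>
        (\<exists>t s'. exec ((card (pverts D) + 1) ^ d) P (input_store D es) t s' \<and>
           t \<le> C * card (pverts D) \<and> s' ''out'' 0 = F D))"

definition decides_in_linear_time ::
  "com \<Rightarrow> (nat pair_pre_digraph \<Rightarrow> bool) \<Rightarrow> (nat pair_pre_digraph \<Rightarrow> bool) \<Rightarrow> bool" where
  "decides_in_linear_time P Inst Q \<longleftrightarrow> computes_in_linear_time P Inst (\<lambda>D. of_bool (Q D))"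

end

theory Submission
  imports Defs
begin

text \<open>
  One program computes \<open>dilambda j T\<close> for every ditree \<open>T\<close> in linear time; both claims follow from it,
  the first by comparing the result with \<open>j + 1\<close>, the second by restricting the inputs.

  \<^emph>\<open>From labelings to homomorphisms.\<close> In a ditree, \<open>ddist x z = 2\<close> means that there is a vertex \<open>y\<close>
  with arcs \<open>(x, y)\<close> and \<open>(y, z)\<close>. So a labeling is a function for which the labels of adjacent vertices differ by
  at least \<open>j\<close> and, at each vertex, the labels of the in-neighbours are disjoint from those of
  the out-neighbours. If each vertex also guesses the set of labels of its in-neighbours, all these conditions
  are conditions on single arcs. Hence \<open>dilambda j T \<le> k\<close> iff \<open>T\<close> has a homomorphism
  into a digraph of bounded size that depends on \<open>j\<close> and \<open>k\<close> only (\<open>labeling_iff_solvable\<close>,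
  \<open>dilambda_le_iff\<close>). The closed walk \<open>0, j + 1, 1, j + 2\<close> of labels shows
  \<open>dilambda j T \<le> j + 2\<close> (\<open>labeling_exists\<close>), so it suffices to test \<open>k \<le> j + 1\<close>.

  \<^emph>\<open>Homomorphisms of trees.\<close> Every vertex keeps a list of candidate values. If \<open>u\<close> is a leaf with
  neighbour \<open>p\<close>, then strike out at \<open>p\<close> the candidates that are compatible with no candidate of \<open>u\<close>,
  and delete the arc. Solvability is preserved (\<open>solvable_remove_leaf\<close>). A forest with an arc has a leaf
  (\<open>ditree_arc_forest\<close>), so in the end no arc is left, and a homomorphism exists iff no list has become
  empty.

  \<^emph>\<open>Linear time.\<close> No adjacency lists are needed to find the neighbour of a leaf: for every vertex the
  program keeps the numbers and the sums of its remaining in- and out-neighbours, and if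
  there is only one neighbour, then the sum is its name. A pass over the vertices follows, from each
  vertex, the chain of vertices that become leaves (\<open>runs_shave\<close>). Each step of a chain
  deletes an arc, and there are at most \<open>n\<close> arcs (\<open>card_arc_forest_le\<close>), so the whole pass is linear
  although a single chain may be long; the number of arcs left serves as the potential.
\<close>

section \<open>Forests\<close>

text \<open>Deleting arcs, rather than vertices, keeps the vertex set fixed; a stripped vertex just becomes isolated.\<close>

definition leaf_arc :: "('a \<times> 'a) set \<Rightarrow> 'a \<Rightarrow> 'a \<times> 'a \<Rightarrow> bool" where
  "leaf_arc R u e \<longleftrightarrow> (\<exists>p. p \<noteq> u \<and> e \<in> {(u, p), (p, u)} \<and> e \<in> R \<and> u \<notin> Field (R - {e}))"

text \<open>The stripping argument needs acyclicity in this form: leaves keep turning up while arcs are deleted.\<close>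

definition arc_forest :: "('a \<times> 'a) set \<Rightarrow> bool" where
  "arc_forest E \<longleftrightarrow> finite E \<and> (\<forall>R \<subseteq> E. R \<noteq> {} \<longrightarrow> (\<exists>u e. leaf_arc R u e))"

lemma arc_forest_subset: "arc_forest E \<Longrightarrow> R \<subseteq> E \<Longrightarrow> arc_forest R"
  unfolding arc_forest_def by (meson finite_subset order_trans)

lemma arc_forest_induct [consumes 1, case_names empty leaf]:
  assumes "arc_forest R" and "P {}"
    and step: "\<And>R u e. arc_forest R \<Longrightarrow> leaf_arc R u e \<Longrightarrow> P (R - {e}) \<Longrightarrow> P R"
  shows "P R"
proof -
  have "finite R" using assms(1) by (simp add: arc_forest_def)
  then show ?thesis using assms(1)
  proof (induction R rule: finite_psubset_induct)
    case (psubset R)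
    show ?case
    proof (cases "R = {}")
      case False
      then have "\<exists>u e. leaf_arc R u e"
        using psubset.prems unfolding arc_forest_def by simp
      then obtain u e where e: "leaf_arc R u e" by (elim exE)
      then have "R - {e} \<subset> R" by (auto simp: leaf_arc_def)
      then show ?thesis
        using psubset e step arc_forest_subset by (metis Diff_subset)
    qed (simp add: assms(2))
  qed
qed

text \<open>Each leaf removal isolates a vertex, so there are not more arcs than vertices.\<close>

lemma card_arc_forest_le:
  assumes "arc_forest R" "finite V" "Field R \<subseteq> V"
  shows "card R \<le> card V"
  using assms
proof (induction arbitrary: V rule: arc_forest_induct)
  case (leaf R u e)
  from leaf.hyps have u: "u \<notin> Field (R - {e})" "e \<in> R" "u \<in> Field R"
    by (auto simp: leaf_arc_def Field_def)
  have fin: "finite R" using leaf.hyps by (simp add: arc_forest_def)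
  have "Field (R - {e}) \<subseteq> V - {u}"
    using u leaf.prems(2) by (auto simp: Field_def)
  then have "card (R - {e}) \<le> card (V - {u})"
    using leaf.prems by (intro leaf.IH) auto
  moreover have "card R = Suc (card (R - {e}))"
    using u fin by (metis card_Suc_Diff1)
  moreover have "card V = Suc (card (V - {u}))"
    using u leaf.prems by (metis card_Suc_Diff1 subsetD)
  ultimately show ?case by simp
qed simp

lemma parcs_mk_symmetric_proj: "parcs (mk_symmetric (with_proj D)) = parcs D \<union> (parcs D)\<inverse>"
  by (auto simp: parcs_mk_symmetric)

lemma set_vwalk_arcs_mono: "set (vwalk_arcs (take k p)) \<subseteq> set (vwalk_arcs p)"
  by (metis append_take_drop_id set_vwalk_arcs_append1)

text \<open>The end of a longest path of the underlying graph has no second neighbour: off the path it would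
  prolong the path, on the path it would close a cycle.\<close>

lemma ditree_arc_forest:
  assumes "ditree D"
  shows "arc_forest (parcs D)"
  unfolding arc_forest_def
proof (intro conjI allI impI)
  have fin: "pair_fin_digraph D" and asym: "\<And>x y. (x, y) \<in> parcs D \<Longrightarrow> (y, x) \<notin> parcs D"
    and acyc: "\<And>p. \<not> underlying_cycle D p"
    using assms by (auto simp: ditree_def)
  interpret pair_fin_digraph D by (rule fin)
  show "finite (parcs D)" by simp
  fix R assume R: "R \<subseteq> parcs D" "R \<noteq> {}"
  let ?adj = "R \<union> R\<inverse>"
  \<comment> \<open>Paths with an arc: the first vertex of a longest one is the leaf.\<close>
  define path where "path p \<longleftrightarrow> distinct p \<and> 2 \<le> length p \<and> set p \<subseteq> pverts D
    \<and> set (vwalk_arcs p) \<subseteq> ?adj" for p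
  have adj_verts: "x \<in> pverts D \<and> y \<in> pverts D \<and> x \<noteq> y" if "(x, y) \<in> ?adj" for x y
    using that R(1) asym[of x y] in_arcsD1[of x y] in_arcsD2[of x y] in_arcsD1[of y x] in_arcsD2[of y x] by blast
  obtain x y where "(x, y) \<in> R" using R(2) by auto
  then have "path [x, y]" using adj_verts[of x y] by (auto simp: path_def)
  moreover have "length p < Suc (card (pverts D))" if "path p" for p
    using that card_mono[OF finite_verts, of "set p"] distinct_card[of p]
    by (simp add: path_def)
  ultimately obtain p where p: "path p" and longest: "\<And>q. path q \<Longrightarrow> length q \<le> length p"
    using ex_has_greatest_nat[of path "[x, y]" length "Suc (card (pverts D))"] by auto
  obtain u v r where puv: "p = u # v # r"
    using p by (cases p rule: vwalk_arcs.cases) (auto simp: path_def)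
  have uv: "(u, v) \<in> ?adj" using p by (simp add: path_def puv)
  have only: "w = v" if w: "(u, w) \<in> ?adj" for w
  proof (rule ccontr)
    assume "w \<noteq> v"
    show False
    proof (cases "w \<in> set p")
      case False
      have "path (w # p)"
        using p False w adj_verts[OF w] by (auto simp: path_def puv)
      then show False using longest[of "w # p"] by simp
    next
      case True
      then obtain i where i: "i < length p" "p ! i = w" by (auto simp: in_set_conv_nth)
      have "p ! 0 \<noteq> w" "p ! 1 \<noteq> w" using \<open>w \<noteq> v\<close> adj_verts[OF w] by (auto simp: puv)
      then have "i \<noteq> 0" "i \<noteq> 1" using i(2) by metis+
      then have i2: "2 \<le> i" by simp
      let ?q = "take (Suc i) p"
      have ends: "last ?q = w" "hd ?q = u"
        using i(2) by (simp add: take_Suc_conv_app_nth[OF i(1)], simp add: puv)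
      have "set (vwalk_arcs ?q) \<subseteq> parcs D \<union> (parcs D)\<inverse>"
        proof -
        have "set (vwalk_arcs ?q) \<subseteq> ?adj"
          using set_vwalk_arcs_mono[of "Suc i" p] p unfolding path_def by (meson order_trans)
        also have "\<dots> \<subseteq> parcs D \<union> (parcs D)\<inverse>" using R(1) by auto
        finally show ?thesis .
      qed
      moreover have "set ?q \<subseteq> pverts D" using p set_take_subset[of "Suc i" p] unfolding path_def by (meson order_trans)
      moreover have "distinct ?q" "3 \<le> length ?q" "?q \<noteq> []"
        using p i i2 by (auto simp: path_def)
      moreover have "(w, u) \<in> parcs D \<union> (parcs D)\<inverse>" using w R(1) by auto
      ultimately have "underlying_cycle D ?q"
        unfolding underlying_cycle_def vpath_def vwalk_def ends
        by (simp add: parcs_mk_symmetric_proj)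
      then show False using acyc by simp
    qed
  qed
  obtain e where e: "e \<in> R" "e \<in> {(u, v), (v, u)}" using uv by auto
  have "u \<notin> Field (R - {e})"
  proof
    assume "u \<in> Field (R - {e})"
    then obtain w where "(u, w) \<in> R - {e} \<or> (w, u) \<in> R - {e}" by (auto simp: Field_def)
    moreover from this have "w = v" using only[of w] by blast
    moreover have "(u, v) \<in> R \<Longrightarrow> (v, u) \<notin> R" using R(1) asym[of u v] by blast
    ultimately show False using e by blast
  qed
  moreover have "v \<noteq> u" using adj_verts[OF uv] by metis
  ultimately have "leaf_arc R u e"
    unfolding leaf_arc_def using e by (intro exI[of _ v] conjI)
  then show "\<exists>u e. leaf_arc R u e" by (intro exI)
qed

section \<open>List homomorphisms of forests\<close>

text \<open>This is list homomorphism: \<open>A\<close> is the arc relation of the target, and \<open>L v\<close> the list of \<open>v\<close>.\<close>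

definition solvable :: "'a set \<Rightarrow> ('a \<times> 'a) set \<Rightarrow> ('b \<Rightarrow> 'b \<Rightarrow> bool) \<Rightarrow> ('a \<Rightarrow> 'b set) \<Rightarrow> bool" where
  "solvable V E A L \<longleftrightarrow> (\<exists>g. (\<forall>(x, y) \<in> E. A (g x) (g y)) \<and> (\<forall>v \<in> V. g v \<in> L v))"

lemma solvable_empty: "solvable V {} A L \<longleftrightarrow> (\<forall>v \<in> V. L v \<noteq> {})"
  unfolding solvable_def by (auto intro!: exI[of _ "\<lambda>v. SOME h. h \<in> L v"] simp: some_in_eq)

text \<open>A solution of the smaller instance may have the wrong value at \<open>u\<close>. Since no other arc meets \<open>u\<close>,
  that value can be replaced by one that supports the value at \<open>p\<close>.\<close>

lemma solvable_remove_leaf: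
  assumes "e \<in> R" "u \<notin> Field (R - {e})" "p \<noteq> u" "u \<in> V" "p \<in> V"
    and e: "e = (u, p) \<and> B = A \<or> e = (p, u) \<and> B = (\<lambda>x y. A y x)"
  shows "solvable V R A L \<longleftrightarrow> solvable V (R - {e}) A (L(p := {h \<in> L p. \<exists>h' \<in> L u. B h' h}))"
    (is "_ \<longleftrightarrow> solvable _ _ _ ?L")
proof
  assume "solvable V R A L"
  then obtain g where g: "\<And>x y. (x, y) \<in> R \<Longrightarrow> A (g x) (g y)" "\<And>v. v \<in> V \<Longrightarrow> g v \<in> L v"
    by (auto simp: solvable_def)
  then have "B (g u) (g p)" using assms(1) e by auto
  then show "solvable V (R - {e}) A ?L"
    unfolding solvable_def using g assms(4,5) by (intro exI[of _ g]) auto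
next
  assume "solvable V (R - {e}) A ?L"
  then obtain g where g: "\<And>x y. (x, y) \<in> R - {e} \<Longrightarrow> A (g x) (g y)" "\<And>v. v \<in> V \<Longrightarrow> g v \<in> ?L v"
    by (auto simp: solvable_def)
  from g(2)[of p] assms(5) obtain h where h: "h \<in> L u" "B h (g p)" by auto
  have "A ((g(u := h)) x) ((g(u := h)) y)" if "(x, y) \<in> R" for x y
  proof (cases "(x, y) = e")
    case True
    then show ?thesis using e h assms(3) by auto
  next
    case False
    then have "x \<noteq> u" "y \<noteq> u" using that assms(2) by (auto simp: Field_def)
    then show ?thesis using g(1) that False by simp
  qed
  moreover have "(g(u := h)) v \<in> L v" if "v \<in> V" for v
    using g(2)[OF that] h by (auto split: if_splits)
  ultimately show "solvable V R A L" unfolding solvable_def by blast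
qed

text \<open>If every target vertex in \<open>B\<close> has an in- and an out-neighbour in \<open>B\<close>, pruning a list \<open>B\<close> against a
  list \<open>B\<close> deletes nothing, so no list ever becomes empty.\<close>

lemma solvable_forest:
  assumes "arc_forest E" and "\<And>h. h \<in> B \<Longrightarrow> \<exists>h' \<in> B. A h h'" "\<And>h. h \<in> B \<Longrightarrow> \<exists>h' \<in> B. A h' h" "B \<noteq> {}"
  shows "solvable UNIV E A (\<lambda>_. B)"
  using assms(1)
proof (induction rule: arc_forest_induct)
  case empty
  show ?case using assms(4) by (simp add: solvable_empty)
next
  case (leaf R u e)
  then obtain p where p: "p \<noteq> u" "e \<in> R" "u \<notin> Field (R - {e})" "e \<in> {(u, p), (p, u)}"
    by (auto simp: leaf_arc_def)
  show ?case
  proof (cases "e = (u, p)")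
    case True
    have "(\<lambda>_. B)(p := {h \<in> B. \<exists>h' \<in> B. A h' h}) = (\<lambda>_. B)" using assms(3) by (auto simp: fun_eq_iff)
    with solvable_remove_leaf[of e R u p UNIV A A "\<lambda>_. B"] p True leaf.IH show ?thesis by simp
  next
    case False
    then have e: "e = (p, u)" using p by auto
    have "(\<lambda>_. B)(p := {h \<in> B. \<exists>h' \<in> B. A h h'}) = (\<lambda>_. B)" using assms(2) by (auto simp: fun_eq_iff)
    with solvable_remove_leaf[of e R u p UNIV "\<lambda>x y. A y x" A "\<lambda>_. B"] p e leaf.IH show ?thesis by simp
  qed
qed

section \<open>Labelings\<close>

text \<open>A dipath of length two between \<open>x\<close> and \<open>y\<close> is always shortest: an arc from \<open>x\<close> to \<open>y\<close> would
  close a cycle with it.\<close>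

lemma ddist_eq_2_iff:
  assumes "ditree D"
  shows "ddist D x y = 2 \<longleftrightarrow> (\<exists>z. (x, z) \<in> parcs D \<and> (z, y) \<in> parcs D)"
proof
  let ?P = "{p. dipath D p \<and> hd p = x \<and> last p = y}"
  assume *: "ddist D x y = 2"
  define A where "A = (\<lambda>p. enat (vwalk_length p)) ` ?P"
  have Inf: "Inf A = 2" using * by (simp only: ddist_def A_def)
  have "A \<noteq> {}"
  proof
    assume "A = {}"
    then show False using Inf by (simp add: Inf_enat_def)
  qed
  then have "2 \<in> A" using wellorder_InfI[of _ A] Inf by (metis ex_in_conv)
  then obtain p where p: "p \<in> ?P" "2 = enat (vwalk_length p)" unfolding A_def by (elim imageE)
  then have "vwalk_length p = 2" by (metis enat.inject numeral_eq_enat)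
  then have "length p = 3" by simp
  then obtain a b c where "p = [a, b, c]" 
    by (auto simp: numeral_3_eq_3 length_Suc_conv)
  then show "\<exists>z. (x, z) \<in> parcs D \<and> (z, y) \<in> parcs D"
    using p by (auto simp: vpath_def vwalk_def)
next
  let ?P = "{p. dipath D p \<and> hd p = x \<and> last p = y}"
  have fin: "pair_fin_digraph D" and asym: "\<And>x y. (x, y) \<in> parcs D \<Longrightarrow> (y, x) \<notin> parcs D"
    and acyc: "\<And>p. \<not> underlying_cycle D p"
    using assms by (auto simp: ditree_def)
  interpret pair_fin_digraph D by (rule fin)
  assume "\<exists>z. (x, z) \<in> parcs D \<and> (z, y) \<in> parcs D"
  then obtain z where z: "(x, z) \<in> parcs D" "(z, y) \<in> parcs D" by auto
  then have dist: "distinct [x, z, y]" using asym by auto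
  have vs: "x \<in> pverts D" "z \<in> pverts D" "y \<in> pverts D" using z in_arcsD1 in_arcsD2 by auto
  have "[x, z, y] \<in> ?P" using z dist vs by (auto simp: vpath_def vwalk_def)
  moreover have "2 \<le> vwalk_length p" if p: "p \<in> ?P" for p
  proof (rule ccontr)
    assume "\<not> 2 \<le> vwalk_length p"
    then have "length p \<le> 2" by simp
    moreover have "p \<noteq> []" using p by (simp add: vpath_def vwalk_def)
    ultimately have "(\<exists>a. p = [a]) \<or> (\<exists>a b. p = [a, b])"
      by (cases p rule: vwalk_arcs.cases) auto
    then show False
    proof (elim disjE exE)
      fix a assume "p = [a]"
      then show False using p dist by auto
    next
      fix a b assume "p = [a, b]"
      then have "p = [x, y]" using p by simp
      then have "(x, y) \<in> parcs D" using p by (auto simp: vpath_def vwalk_def)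
      then have "underlying_cycle D [x, z, y]"
        using z dist vs unfolding underlying_cycle_def vpath_def vwalk_def
        by (simp add: parcs_mk_symmetric_proj)
      then show False using acyc by simp
    qed
  qed
  ultimately show "ddist D x y = 2"
    unfolding ddist_def numeral_eq_enat
  proof (intro antisym)
    assume P: "[x, z, y] \<in> ?P"
    show "(INF p \<in> ?P. enat (vwalk_length p)) \<le> enat 2"
      by (rule INF_lower2[OF P]) simp
    assume "\<And>p. p \<in> ?P \<Longrightarrow> 2 \<le> vwalk_length p"
    then show "enat 2 \<le> (INF p \<in> ?P. enat (vwalk_length p))"
      by (intro INF_greatest) (simp del: vwalk_length_simp)
  qed
qed

lemma L_labeling_iff:
  assumes "ditree D"
  shows "L_labeling j D f \<longleftrightarrow>
    (\<forall>x y. (x, y) \<in> parcs D \<longrightarrow> f x + j \<le> f y \<or> f y + j \<le> f x) \<and>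
    (\<forall>x y z. (x, y) \<in> parcs D \<longrightarrow> (y, z) \<in> parcs D \<longrightarrow> f x \<noteq> f z)"
proof -
  interpret pair_fin_digraph D using assms by (simp add: ditree_def)
  have far: "\<bar>int (f x) - int (f y)\<bar> \<ge> int j \<longleftrightarrow> f x + j \<le> f y \<or> f y + j \<le> f x"
    "\<bar>int (f x) - int (f y)\<bar> \<ge> 1 \<longleftrightarrow> f x \<noteq> f y" for x y
    by arith+
  have ends: "x \<in> pverts D \<and> y \<in> pverts D" if "(x, y) \<in> parcs D" for x y
    using in_arcsD1[OF that] in_arcsD2[OF that] by blast
  show ?thesis
  proof
    assume "L_labeling j D f"
    then have *: "(x, y) \<in> parcs D \<longrightarrow> f x + j \<le> f y \<or> f y + j \<le> f x"
      "(\<exists>z. (x, z) \<in> parcs D \<and> (z, y) \<in> parcs D) \<longrightarrow> f x \<noteq> f y"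
      if "x \<in> pverts D" "y \<in> pverts D" for x y
      using that unfolding L_labeling_def ddist_eq_2_iff[OF assms] far by simp_all
    show "(\<forall>x y. (x, y) \<in> parcs D \<longrightarrow> f x + j \<le> f y \<or> f y + j \<le> f x) \<and>
      (\<forall>x y z. (x, y) \<in> parcs D \<longrightarrow> (y, z) \<in> parcs D \<longrightarrow> f x \<noteq> f z)"
      using * ends by (intro conjI allI impI) blast+
  next
    assume "(\<forall>x y. (x, y) \<in> parcs D \<longrightarrow> f x + j \<le> f y \<or> f y + j \<le> f x) \<and>
      (\<forall>x y z. (x, y) \<in> parcs D \<longrightarrow> (y, z) \<in> parcs D \<longrightarrow> f x \<noteq> f z)"
    then show "L_labeling j D f"
      unfolding L_labeling_def ddist_eq_2_iff[OF assms] far by blast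
  qed
qed

text \<open>In a state \<open>(k, a, S)\<close>, \<open>a\<close> is the label of the vertex and \<open>S\<close> the set of labels that its in-neighbours
  may have. The out-neighbours must avoid \<open>S\<close>, which turns the distance-two condition into a
  condition on single arcs. The bound \<open>k\<close> on the labels is carried along so that a single target digraph,
  the disjoint union over \<open>k\<close>, answers the question for all \<open>k\<close> at once.\<close>

type_synonym state = "nat \<times> nat \<times> nat list"

fun arc_ok :: "nat \<Rightarrow> state \<Rightarrow> state \<Rightarrow> bool" where
  "arc_ok j (k, a, S) (k', a', S') \<longleftrightarrow>
     k = k' \<and> (a + j \<le> a' \<or> a' + j \<le> a) \<and> a \<in> set S' \<and> a' \<notin> set S"

definition states :: "nat \<Rightarrow> state list" where
  "states k = List.product [k] (List.product [0..<Suc k] (subseqs [0..<Suc k]))"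

lemma fst_states: "h \<in> set (states k) \<Longrightarrow> fst h = k"
  by (auto simp: states_def)

text \<open>From a labeling, let \<open>S v\<close> be the set of labels that occur on in-neighbours of \<open>v\<close>; it meets no label of an
  out-neighbour because the labeling separates vertices at distance two.\<close>

lemma labeling_iff_solvable:
  assumes "ditree D"
  shows "(\<exists>f. L_labeling j D f \<and> (\<forall>v \<in> pverts D. f v \<le> k)) \<longleftrightarrow>
    solvable (pverts D) (parcs D) (arc_ok j) (\<lambda>_. set (states k))"
proof
  interpret pair_fin_digraph D using assms by (simp add: ditree_def)
  assume "\<exists>f. L_labeling j D f \<and> (\<forall>v \<in> pverts D. f v \<le> k)"
  then obtain f where f: "L_labeling j D f" "\<And>v. v \<in> pverts D \<Longrightarrow> f v \<le> k" by auto
  note f' = f(1)[unfolded L_labeling_iff[OF assms]]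
  have "\<exists>S. S \<in> set (subseqs [0..<Suc k]) \<and> set S = f ` {x. (x, v) \<in> parcs D}" for v
  proof -
    have "f ` {x. (x, v) \<in> parcs D} \<in> Pow (set [0..<Suc k])"
      using f(2)[OF in_arcsD1] by (auto simp: less_Suc_eq_le simp del: upt_Suc)
    then show ?thesis unfolding subseqs_powset[symmetric] by auto
  qed
  then obtain S where S: "\<And>v. S v \<in> set (subseqs [0..<Suc k])"
    "\<And>v. set (S v) = f ` {x. (x, v) \<in> parcs D}" by metis
  have "arc_ok j (k, f x, S x) (k, f y, S y)" if "(x, y) \<in> parcs D" for x y
  proof -
    have "f y \<notin> set (S x)"
    proof
      assume "f y \<in> set (S x)"
      then obtain w where "(w, x) \<in> parcs D" "f y = f w" unfolding S(2) by (elim imageE CollectE)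
      then show False using f' that by metis
    qed
    moreover have "f x \<in> set (S y)" using that by (simp add: S(2))
    moreover have "f x + j \<le> f y \<or> f y + j \<le> f x" using f' that by blast
    ultimately show ?thesis by simp
  qed
  then show "solvable (pverts D) (parcs D) (arc_ok j) (\<lambda>_. set (states k))"
    unfolding solvable_def using S(1) f(2)
    by (intro exI[of _ "\<lambda>v. (k, f v, S v)"]) (auto simp: states_def less_Suc_eq_le simp del: upt_Suc)
next
  assume "solvable (pverts D) (parcs D) (arc_ok j) (\<lambda>_. set (states k))"
  then obtain g where g: "\<And>x y. (x, y) \<in> parcs D \<Longrightarrow> arc_ok j (g x) (g y)"
    "\<And>v. v \<in> pverts D \<Longrightarrow> g v \<in> set (states k)" by (auto simp: solvable_def)
  define f where "f v = fst (snd (g v))" for v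
  have arc: "(f x + j \<le> f y \<or> f y + j \<le> f x) \<and> f x \<in> set (snd (snd (g y))) \<and> f y \<notin> set (snd (snd (g x)))"
    if "(x, y) \<in> parcs D" for x y
    using g(1)[OF that] by (cases "g x"; cases "g y") (auto simp: f_def)
  have "L_labeling j D f"
    unfolding L_labeling_iff[OF assms]
  proof (intro conjI allI impI)
    show "f x + j \<le> f y \<or> f y + j \<le> f x" if "(x, y) \<in> parcs D" for x y
      using arc[OF that] by simp
    show "f x \<noteq> f z" if "(x, y) \<in> parcs D" "(y, z) \<in> parcs D" for x y z
      using arc[OF that(1)] arc[OF that(2)] by metis
  qed
  moreover have "f v \<le> k" if "v \<in> pverts D" for v
    using g(2)[OF that] by (auto simp: f_def states_def)
  ultimately show "\<exists>f. L_labeling j D f \<and> (\<forall>v \<in> pverts D. f v \<le> k)" by blast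
qed

text \<open>Going round the closed walk \<open>0, j + 1, 1, j + 2\<close> of labels, consecutive labels differ by at least \<open>j\<close>
  and labels two steps apart are distinct; every forest has a homomorphism to a directed 4-cycle.\<close>

lemma labeling_exists:
  assumes "ditree D"
  shows "\<exists>f. L_labeling j D f \<and> (\<forall>v \<in> pverts D. f v \<le> j + 2)"
proof -
  define g where "g i = [0, j + 1, 1, j + 2] ! i" for i :: nat
  have "solvable UNIV (parcs D) (\<lambda>i i'. i' = Suc i mod 4) (\<lambda>_. {..<4})"
  proof (rule solvable_forest[OF ditree_arc_forest[OF assms]])
    show "{..<4::nat} \<noteq> {}" using lessThan_iff[of 0 "4::nat"] by fastforce
    show "\<exists>h' \<in> {..<4}. h = Suc h' mod 4" if "h \<in> {..<4}" for h
      using that by (intro bexI[of _ "(h + 3) mod 4"]) (auto simp: mod_simps)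
  qed auto
  then obtain c where c: "\<And>x y. (x, y) \<in> parcs D \<Longrightarrow> c y = Suc (c x) mod 4" "\<And>v. c v < 4"
    by (auto simp: solvable_def)
  have four: "i = 0 \<or> i = 1 \<or> i = 2 \<or> i = 3" if "i < 4" for i :: nat using that by linarith
  have "L_labeling j D (g \<circ> c)"
    unfolding L_labeling_iff[OF assms]
  proof (intro conjI allI impI)
    show "(g \<circ> c) x + j \<le> (g \<circ> c) y \<or> (g \<circ> c) y + j \<le> (g \<circ> c) x" if "(x, y) \<in> parcs D" for x y
      using four[OF c(2)[of x]] c(1)[OF that] by (auto simp: g_def)
    show "(g \<circ> c) x \<noteq> (g \<circ> c) z" if "(x, y) \<in> parcs D" "(y, z) \<in> parcs D" for x y z
      using four[OF c(2)[of x]] c(1)[OF that(1)] c(1)[OF that(2)] by (auto simp: g_def)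
  qed
  moreover have "(g \<circ> c) v \<le> j + 2" for v
    using four[OF c(2)[of v]] by (auto simp: g_def)
  ultimately show ?thesis by blast
qed

text \<open>Subtracting the smallest label turns a bound on the span into a bound on the labels.\<close>

lemma dilambda_le_iff:
  assumes "ditree D"
  shows "dilambda j D \<le> k \<longleftrightarrow> (\<exists>f. L_labeling j D f \<and> (\<forall>v \<in> pverts D. f v \<le> k))"
proof
  interpret pair_fin_digraph D using assms by (simp add: ditree_def)
  assume *: "dilambda j D \<le> k"
  have "\<exists>k f. L_labeling j D f \<and> label_span D f = k" using labeling_exists[OF assms] by blast
  then have "\<exists>f. L_labeling j D f \<and> label_span D f = dilambda j D"
    unfolding dilambda_def by (rule LeastI_ex)
  then obtain f where f: "L_labeling j D f" "label_span D f = dilambda j D" by (elim exE conjE)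
  let ?m = "Min (f ` pverts D)"
  have le: "?m \<le> f v" "f v \<le> Max (f ` pverts D)" if "v \<in> pverts D" for v
    using that by auto
  have "L_labeling j D (\<lambda>v. f v - ?m)"
    using f(1) unfolding L_labeling_def by (simp add: of_nat_diff[OF le(1)])
  moreover have "f v - ?m \<le> k" if "v \<in> pverts D" for v
    using le[OF that] f(2) * unfolding label_span_def by linarith
  ultimately show "\<exists>f. L_labeling j D f \<and> (\<forall>v \<in> pverts D. f v \<le> k)" by blast
next
  interpret pair_fin_digraph D using assms by (simp add: ditree_def)
  assume "\<exists>f. L_labeling j D f \<and> (\<forall>v \<in> pverts D. f v \<le> k)"
  then obtain f where f: "L_labeling j D f" "\<And>v. v \<in> pverts D \<Longrightarrow> f v \<le> k" by auto
  have "pverts D \<noteq> {}"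
    using assms by (simp add: ditree_def Digraph_Component.connected_def strongly_connected_def)
  then have "Max (f ` pverts D) \<le> k" using f(2) by simp
  then have "label_span D f \<le> k" unfolding label_span_def by simp
  moreover have "dilambda j D \<le> label_span D f"
    unfolding dilambda_def using f(1) by (intro Least_le) blast
  ultimately show "dilambda j D \<le> k" by simp
qed

section \<open>Reasoning about programs\<close>

text \<open>Loop-free programs are executed by the simplifier: \<open>step\<close> is their effect, \<open>safe\<close> says that no number
  overflows, and \<open>time\<close> bounds the cost. The values given to \<open>While\<close> are dummies, made harmless
  by \<open>safe\<close>.\<close>

fun step :: "com \<Rightarrow> store \<Rightarrow> store" where
  "step Skip s = s"
| "step (Write a i e) s = s(a := (s a)(eval s i := eval s e))"
| "step (Seq c d) s = step d (step c s)"
| "step (Cond b c d) s = (if eval s b \<noteq> 0 then step c s else step d s)"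
| "step (While b c) s = s"

fun safe :: "nat \<Rightarrow> com \<Rightarrow> store \<Rightarrow> bool" where
  "safe W Skip s \<longleftrightarrow> True"
| "safe W (Write a i e) s \<longleftrightarrow> fits W s i \<and> fits W s e"
| "safe W (Seq c d) s \<longleftrightarrow> safe W c s \<and> safe W d (step c s)"
| "safe W (Cond b c d) s \<longleftrightarrow> fits W s b \<and> (if eval s b \<noteq> 0 then safe W c s else safe W d s)"
| "safe W (While b c) s \<longleftrightarrow> False"

fun time :: "com \<Rightarrow> nat" where
  "time Skip = 1"
| "time (Write a i e) = cost i + cost e + 1"
| "time (Seq c d) = time c + time d"
| "time (Cond b c d) = cost b + 1 + time c + time d"
| "time (While b c) = 0"

lemma safe_exec: "safe W c s \<Longrightarrow> \<exists>t \<le> time c. exec W c s t (step c s)"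
proof (induction c arbitrary: s)
  case (Seq c d)
  then obtain t u where "t \<le> time c" "exec W c s t (step c s)"
    "u \<le> time d" "exec W d (step c s) u (step d (step c s))" by fastforce
  then show ?case by (intro exI[of _ "t + u"]) (auto intro: exec.Seq)
next
  case (Cond b c d)
  show ?case
  proof (cases "eval s b = 0")
    case True
    with Cond obtain t where "t \<le> time d" "exec W d s t (step d s)" by fastforce
    with True Cond.prems show ?thesis
      by (intro exI[of _ "cost b + 1 + t"]) (auto intro: exec.CondFalse[simplified])
  next
    case False
    with Cond obtain t where "t \<le> time c" "exec W c s t (step c s)" by fastforce
    with False Cond.prems show ?thesis
      by (intro exI[of _ "cost b + 1 + t"]) (auto intro: exec.CondTrue[simplified])
  qed
next
  case Skip
  then show ?case using exec.Skip by fastforce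
qed (auto intro: exec.Write[simplified])

text \<open>A Hoare triple with time credits: the program is started with \<open>q\<close> credits, pays for every operation, and hands
  at least \<open>q'\<close> credits on to the postcondition. Invariants that mention the credits thereby
  express amortized bounds.\<close>

definition runs :: "nat \<Rightarrow> com \<Rightarrow> store \<Rightarrow> nat \<Rightarrow> (nat \<Rightarrow> store \<Rightarrow> bool) \<Rightarrow> bool" where
  "runs W c s q Q \<longleftrightarrow> (\<exists>t s' q'. exec W c s t s' \<and> t + q' \<le> q \<and> Q q' s')"

lemma runs_safe:
  assumes "safe W c s" "time c + q' \<le> q" "Q q' (step c s)"
  shows "runs W c s q Q"
proof -
  obtain t where "t \<le> time c" "exec W c s t (step c s)" using safe_exec[OF assms(1)] by auto
  with assms(2,3) show ?thesis unfolding runs_def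
    by (meson add_le_mono1 le_trans)
qed

lemma runs_Seq:
  assumes "runs W c s q P" and "\<And>q' s'. P q' s' \<Longrightarrow> runs W d s' q' Q"
  shows "runs W (Seq c d) s q Q"
proof -
  from assms(1) obtain t s1 q1 where 1: "exec W c s t s1" "t + q1 \<le> q" "P q1 s1"
    by (auto simp: runs_def)
  from assms(2)[OF 1(3)] obtain u s2 q2 where 2: "exec W d s1 u s2" "u + q2 \<le> q1" "Q q2 s2"
    by (auto simp: runs_def)
  show ?thesis unfolding runs_def
    using exec.Seq[OF 1(1) 2(1)] 1(2) 2(2,3) by (intro exI[of _ "t + u"] exI[of _ s2] exI[of _ q2]) auto
qed

lemma runs_mono:
  assumes "runs W c s q P" "q + r \<le> q'" "\<And>p s'. P p s' \<Longrightarrow> Q (p + r) s'"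
  shows "runs W c s q' Q"
proof -
  from assms(1) obtain t s1 q1 where "exec W c s t s1" "t + q1 \<le> q" "P q1 s1"
    by (auto simp: runs_def)
  with assms(2,3) show ?thesis unfolding runs_def
    by (intro exI[of _ t] exI[of _ s1] exI[of _ "q1 + r"]) auto
qed

lemma runs_Seq_add:
  assumes "runs W c s q1 (\<lambda>_. P)" and "\<And>s'. P s' \<Longrightarrow> runs W d s' q2 Q"
  shows "runs W (Seq c d) s (q1 + q2) Q"
proof (rule runs_Seq)
  show "runs W c s (q1 + q2) (\<lambda>q' s'. q2 \<le> q' \<and> P s')"
    using assms(1) by (rule runs_mono[where r = q2]) auto
  show "runs W d s' q' Q" if "q2 \<le> q' \<and> P s'" for q' s'
    using that by (intro runs_mono[OF assms(2), where r = 0]) auto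
qed

text \<open>The loop invariant also holds a potential \<open>q\<close>, from which every iteration pays for itself and for the test;
  since the test costs something, the potential is also the termination measure.\<close>

lemma runs_While:
  assumes fits: "\<And>q s. I q s \<Longrightarrow> fits W s b"
    and body: "\<And>q s. I q s \<Longrightarrow> eval s b \<noteq> 0 \<Longrightarrow> \<exists>q1. q1 + cost b + 1 \<le> q \<and> runs W c s q1 I"
    and "I q s"
  shows "runs W (While b c) s (q + cost b + 1) (\<lambda>q' s'. I q' s' \<and> eval s' b = 0)"
  using assms(3)
proof (induction q arbitrary: s rule: less_induct)
  case (less q)
  show ?case
  proof (cases "eval s b = 0")
    case True
    with fits[OF less.prems] less.prems show ?thesis unfolding runs_def
      by (intro exI[of _ "cost b + 1"] exI[of _ s] exI[of _ q])
        (auto intro: exec.WhileFalse[simplified])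
  next
    case False
    then obtain q1 where q1: "q1 + cost b + 1 \<le> q" "runs W c s q1 I"
      using body less.prems by blast
    then obtain t s1 q2 where 1: "exec W c s t s1" "t + q2 \<le> q1" "I q2 s1"
      by (auto simp: runs_def)
    with q1 have "q2 < q" by simp
    from less.IH[OF this 1(3)] obtain u s2 q3 where
      2: "exec W (While b c) s1 u s2" "u + q3 \<le> q2 + cost b + 1" "I q3 s2" "eval s2 b = 0"
      by (auto simp: runs_def)
    show ?thesis unfolding runs_def
      using exec.WhileTrue[OF fits[OF less.prems] False 1(1) 2(1)] q1(1) 1(2) 2
      by (intro exI[of _ "cost b + 1 + t + u"] exI[of _ s2] exI[of _ q3]) auto
  qed
qed

section \<open>The program\<close>

definition Var :: "string \<Rightarrow> exp" where [simp]: "Var a = Read a (Const 0)"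
definition Assign :: "string \<Rightarrow> exp \<Rightarrow> com" where [simp]: "Assign a e = Write a (Const 0) e"
definition Incr :: "string \<Rightarrow> com" where [simp]: "Incr a = Assign a (Op Plus (Var a) (Const 1))"

definition update :: "binop \<Rightarrow> string \<Rightarrow> string \<Rightarrow> exp \<Rightarrow> com" where
  [simp]: "update b a i e = Write a (Var i) (Op b (Read a (Var i)) e)"

fun seqs :: "com list \<Rightarrow> com" where
  "seqs [] = Skip"
| "seqs (c # cs) = Seq c (seqs cs)"

text \<open>A conjunction; the operands will be 0 or 1, so the product stays small.\<close>

fun all_nonzero :: "exp list \<Rightarrow> exp" where
  "all_nonzero [] = Const 1"
| "all_nonzero (e # es) = Op Times e (all_nonzero es)"

text \<open>Each state has an array of its own, in which entry \<open>v\<close> is 1 iff the state has been struck out at \<open>v\<close>.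
  As all cells are 0 initially, every state starts as a candidate everywhere.\<close>

definition flag :: "'h::countable \<Rightarrow> string" where
  "flag h = CHR ''F'' # replicate (to_nat h) CHR ''x''"

definition all_states :: "nat \<Rightarrow> state list" where
  "all_states j = concat (map states [0..<j + 2])"

text \<open>\<open>u\<close> is the leaf and \<open>p\<close> its neighbour; \<open>B h' h\<close> says that \<open>h'\<close> at \<open>u\<close> is compatible with \<open>h\<close> at \<open>p\<close>,
  so that one program text serves both directions of the arc.\<close>

definition no_support :: "('h::countable \<Rightarrow> 'h \<Rightarrow> bool) \<Rightarrow> 'h list \<Rightarrow> 'h \<Rightarrow> exp" where
  "no_support B hs h = all_nonzero (map (\<lambda>h'. Read (flag h') (Var ''u'')) (filter (\<lambda>h'. B h' h) hs))"

definition prune :: "('h::countable \<Rightarrow> 'h \<Rightarrow> bool) \<Rightarrow> 'h list \<Rightarrow> 'h list \<Rightarrow> com" where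
  "prune B hs gs = seqs (map (\<lambda>h.
     Cond (no_support B hs h) (Write (flag h) (Var ''p'') (Const 1)) Skip) gs)"

text \<open>The degree and neighbour-sum tables are linear in the set of arcs, so the same text enters an arc (with
  \<open>Plus\<close>) and deletes it (with \<open>Minus\<close>).\<close>

definition tally :: "binop \<Rightarrow> com" where
  "tally b = seqs
    [update b ''od'' ''x'' (Const 1), update b ''os'' ''x'' (Var ''y''),
     update b ''id'' ''y'' (Const 1), update b ''is'' ''y'' (Var ''x'')]"

definition load_body :: com where
  "load_body = seqs
    [Assign ''x'' (Read ''tail'' (Var ''i'')), Assign ''y'' (Read ''head'' (Var ''i'')),
     tally Plus, Incr ''i'']"

definition load :: com where
  "load = While (Op Less (Var ''i'') (Var ''m'')) load_body"

definition is_leaf :: exp where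
  "is_leaf = Op Equal (Op Plus (Read ''od'' (Var ''u'')) (Read ''id'' (Var ''u''))) (Const 1)"

text \<open>At a leaf one of the two neighbour sums is 0 and the other one is the neighbour. After the
  cut, the program goes on with that neighbour, which may have become a leaf.\<close>

definition cut :: "nat \<Rightarrow> com" where
  "cut j = Seq (Assign ''p'' (Op Plus (Read ''os'' (Var ''u'')) (Read ''is'' (Var ''u''))))
    (Seq (Cond (Read ''od'' (Var ''u''))
        (Seq (prune (arc_ok j) (all_states j) (all_states j))
          (Seq (Assign ''x'' (Var ''u'')) (Assign ''y'' (Var ''p''))))
        (Seq (prune (\<lambda>h' h. arc_ok j h h') (all_states j) (all_states j))
          (Seq (Assign ''x'' (Var ''p'')) (Assign ''y'' (Var ''u'')))))
    (Seq (tally Minus) (Assign ''u'' (Var ''p''))))"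

definition strip :: "nat \<Rightarrow> com" where
  "strip j = While (Op Less (Var ''v'') (Var ''n''))
    (Seq (Assign ''u'' (Var ''v'')) (Seq (While is_leaf (cut j)) (Incr ''v'')))"

text \<open>The scans are run for increasing \<open>k\<close>, so the last one that finds an empty list of candidates leaves
  the largest \<open>k + 1\<close> with \<open>k < dilambda j D\<close> in \<open>out\<close>, which is \<open>dilambda j D\<close> itself; if there is
  none, the initial 0 remains.\<close>

definition scan_test :: "nat \<Rightarrow> com" where
  "scan_test k = Seq (Cond (all_nonzero (map (\<lambda>h. Read (flag h) (Var ''w'')) (states k)))
      (Assign ''out'' (Const (Suc k))) Skip) (Incr ''w'')"

definition scan :: "nat \<Rightarrow> com" where
  "scan k = Seq (Assign ''w'' (Const 0)) (While (Op Less (Var ''w'') (Var ''n'')) (scan_test k))"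

fun scans :: "nat \<Rightarrow> com" where
  "scans 0 = Skip"
| "scans (Suc k) = Seq (scans k) (scan k)"

definition lambda_program :: "nat \<Rightarrow> com" where
  "lambda_program j = Seq load (Seq (strip j) (scans (j + 2)))"

section \<open>Correctness of the loop-free parts\<close>

lemma flag_inject [simp]: "flag h = flag h' \<longleftrightarrow> h = h'"
  by (auto simp: flag_def dest: arg_cong[of _ _ length])

lemma flag_neq [simp]:
  "flag h = c # cs \<longleftrightarrow> c = CHR ''F'' \<and> cs = replicate (to_nat h) CHR ''x''"
  "c # cs = flag h \<longleftrightarrow> c = CHR ''F'' \<and> cs = replicate (to_nat h) CHR ''x''"
  by (auto simp: flag_def)

lemma eval_all_nonzero: "eval s (all_nonzero es) = 0 \<longleftrightarrow> (\<exists>e \<in> set es. eval s e = 0)"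
  by (induction es) auto

lemma fits_all_nonzero:
  assumes "\<And>e. e \<in> set es \<Longrightarrow> fits W s e \<and> eval s e \<le> 1" "1 \<le> W"
  shows "fits W s (all_nonzero es)"
proof -
  have "fits W s (all_nonzero es) \<and> eval s (all_nonzero es) \<le> 1"
    using assms
  proof (induction es)
    case (Cons e es)
    then have IH: "fits W s (all_nonzero es)" "eval s (all_nonzero es) \<le> 1"
      and e: "fits W s e" "eval s e \<le> 1" by simp_all
    then have "eval s e * eval s (all_nonzero es) \<le> 1" using mult_le_mono[OF e(2) IH(2)] by simp
    then show ?case using IH e assms(2) by simp
  qed simp
  then show ?thesis by simp
qed

definition supported :: "('h::countable \<Rightarrow> 'h \<Rightarrow> bool) \<Rightarrow> 'h list \<Rightarrow> nat \<Rightarrow> store \<Rightarrow> 'h \<Rightarrow> bool" where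
  "supported B hs u s h \<longleftrightarrow> (\<exists>h' \<in> set hs. B h' h \<and> s (flag h') u = 0)"

lemma eval_no_support [simp]: "eval s (no_support B hs h) = 0 \<longleftrightarrow> supported B hs (s ''u'' 0) s h"
  by (auto simp: no_support_def eval_all_nonzero supported_def)

definition exclude :: "'h::countable set \<Rightarrow> nat \<Rightarrow> store \<Rightarrow> store" where
  "exclude H p s = (\<lambda>a v. if v = p \<and> a \<in> flag ` H then 1 else s a v)"

lemma prune_Cons: "prune B hs (g # gs) =
    Seq (Cond (no_support B hs g) (Write (flag g) (Var ''p'') (Const 1)) Skip) (prune B hs gs)"
  by (simp add: prune_def)

lemma exclude_exclude: "exclude H p (exclude G p s) = exclude (G \<union> H) p s"
  by (simp add: exclude_def fun_eq_iff image_Un)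

lemma exclude_empty [simp]: "exclude {} p s = s"
  by (simp add: exclude_def)

lemma exclude_other [simp]: "c \<noteq> CHR ''F'' \<Longrightarrow> exclude H p s (c # cs) = s (c # cs)"
  by (auto simp: exclude_def fun_eq_iff)

lemma supported_exclude: "u \<noteq> p \<Longrightarrow> supported B hs u (exclude H p s) = supported B hs u s"
  by (simp add: supported_def exclude_def fun_eq_iff)

lemma step_prune1: "step (Cond (no_support B hs g) (Write (flag g) (Var ''p'') (Const 1)) Skip) s =
    exclude (if supported B hs (s ''u'' 0) s g then {} else {g}) (s ''p'' 0) s"
proof (cases "supported B hs (s ''u'' 0) s g")
  case False
  then show ?thesis by (simp add: exclude_def fun_eq_iff)
qed simp

text \<open>The conditions read the flags at \<open>u\<close> only and the assignments change them at \<open>p\<close> only, so the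
  sequential updates act like a simultaneous one.\<close>

lemma step_prune:
  assumes "s ''u'' 0 \<noteq> s ''p'' 0"
  shows "step (prune B hs gs) s =
    exclude {h \<in> set gs. \<not> supported B hs (s ''u'' 0) s h} (s ''p'' 0) s"
  using assms
proof (induction gs arbitrary: s)
  case Nil
  then show ?case by (simp add: prune_def)
next
  case (Cons g gs)
  let ?s = "exclude (if supported B hs (s ''u'' 0) s g then {} else {g}) (s ''p'' 0) s"
  have "step (prune B hs (g # gs)) s = step (prune B hs gs) ?s"
    unfolding prune_Cons step.simps(3) step_prune1 ..
  also have "\<dots> = exclude {h \<in> set gs. \<not> supported B hs (s ''u'' 0) s h} (s ''p'' 0) ?s"
    using Cons.prems by (subst Cons.IH) (simp_all add: supported_exclude)
  also note exclude_exclude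
  also have "(if supported B hs (s ''u'' 0) s g then {} else {g}) \<union> {h \<in> set gs. \<not> supported B hs (s ''u'' 0) s h}
      = {h \<in> set (g # gs). \<not> supported B hs (s ''u'' 0) s h}"
    by auto
  finally show ?case .
qed

lemma safe_prune:
  assumes "s ''u'' 0 \<noteq> s ''p'' 0" "s ''u'' 0 \<le> W" "s ''p'' 0 \<le> W" "1 \<le> W" "\<And>h. s (flag (h :: 'h)) (s ''u'' 0) \<le> 1"
  shows "safe W (prune B hs (gs :: 'h::countable list)) s"
  using assms
proof (induction gs arbitrary: s)
  case Nil
  then show ?case by (simp add: prune_def)
next
  case (Cons g gs)
  let ?s = "exclude (if supported B hs (s ''u'' 0) s g then {} else {g}) (s ''p'' 0) s"
  have "fits W s (no_support B hs g)"
    unfolding no_support_def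
  proof (rule fits_all_nonzero)
    have "s (flag h) (s ''u'' 0) \<le> W" for h :: 'h
      using Cons.prems(4) Cons.prems(5)[of h] by simp
    then show "fits W s e \<and> eval s e \<le> 1"
      if "e \<in> set (map (\<lambda>h'. Read (flag h') (Var ''u'')) (filter (\<lambda>h'. B h' g) hs))" for e
      using that Cons.prems(2,5) by auto
  qed (use Cons.prems in simp)
  then have *: "safe W (prune B hs (g # gs)) s \<longleftrightarrow> safe W (prune B hs gs) ?s"
    unfolding prune_Cons safe.simps(3) step_prune1 using Cons.prems by simp
  show ?case unfolding *
    using Cons.prems by (intro Cons.IH) (simp_all add: exclude_def)
qed

definition tallied :: "(nat \<times> nat) set \<Rightarrow> store \<Rightarrow> bool" where
  "tallied R s \<longleftrightarrow>
     s ''od'' = (\<lambda>v. card (R `` {v})) \<and> s ''os'' = (\<lambda>v. \<Sum>(R `` {v})) \<and>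
     s ''id'' = (\<lambda>v. card (R\<inverse> `` {v})) \<and> s ''is'' = (\<lambda>v. \<Sum>(R\<inverse> `` {v}))"

lemma converse_insert: "(insert (x, y) R)\<inverse> = insert (y, x) (R\<inverse>)"
  by auto

lemma insert_Image_eq: "insert (x, y) R `` {v} = (if v = x then insert y (R `` {v}) else R `` {v})"
  by auto

lemma step_tally:
  "step (tally b) s = s(
     ''od'' := (s ''od'')(s ''x'' 0 := apply_op b (s ''od'' (s ''x'' 0)) 1),
     ''os'' := (s ''os'')(s ''x'' 0 := apply_op b (s ''os'' (s ''x'' 0)) (s ''y'' 0)),
     ''id'' := (s ''id'')(s ''y'' 0 := apply_op b (s ''id'' (s ''y'' 0)) 1),
     ''is'' := (s ''is'')(s ''y'' 0 := apply_op b (s ''is'' (s ''y'' 0)) (s ''x'' 0)))"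
  by (simp add: tally_def fun_upd_twist)

lemma tallied_Plus:
  assumes "tallied R s" "finite R" "(s ''x'' 0, s ''y'' 0) \<notin> R"
  shows "tallied (insert (s ''x'' 0, s ''y'' 0) R) (step (tally Plus) s)"
proof -
  have "finite (R `` {v})" "finite (R\<inverse> `` {v})" for v
    using assms(2) by (auto intro: finite_Image)
  then show ?thesis
    using assms(1,3) unfolding step_tally
    by (auto simp: tallied_def insert_Image_eq converse_insert fun_eq_iff)
qed

lemma tallied_Minus:
  assumes "tallied R s" "finite R" "(s ''x'' 0, s ''y'' 0) \<in> R"
  shows "tallied (R - {(s ''x'' 0, s ''y'' 0)}) (step (tally Minus) s)"
proof -
  define R' where "R' = R - {(s ''x'' 0, s ''y'' 0)}"
  have R: "R = insert (s ''x'' 0, s ''y'' 0) R'" "(s ''x'' 0, s ''y'' 0) \<notin> R'" "finite R'"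
    using assms by (auto simp: R'_def)
  have "finite (R' `` {v})" "finite (R'\<inverse> `` {v})" for v
    using R(3) by (auto intro: finite_Image)
  then show ?thesis
    using assms(1) R(2) unfolding step_tally R'_def[symmetric]
    by (auto simp: R(1) tallied_def insert_Image_eq converse_insert fun_eq_iff)
qed


text \<open>These factors must not depend on the input. The literal summands pay for loop tests and counters; in
  \<open>scans_cost\<close>, a part of the 15 pays for entering and leaving the loop, which \<open>1 \<le> n\<close> allows to
  charge to the vertices.\<close>

definition load_cost :: nat where "load_cost = time load_body + 6"

definition cut_cost :: "nat \<Rightarrow> nat" where "cut_cost j = time (cut j) + cost is_leaf + 1"

definition strip_cost :: nat where "strip_cost = cost is_leaf + 17"

definition scans_cost :: "nat \<Rightarrow> nat" where "scans_cost k = Suc (\<Sum>i<k. time (scan_test i) + 15)"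

definition candidates :: "store \<Rightarrow> nat \<Rightarrow> nat \<Rightarrow> state set" where
  "candidates s k v = {h \<in> set (states k). s (flag h) v = 0}"

definition degree :: "(nat \<times> nat) set \<Rightarrow> nat \<Rightarrow> nat" where
  "degree R v = card (R `` {v}) + card (R\<inverse> `` {v})"

lemma degree_eq_0_iff: "finite R \<Longrightarrow> degree R v = 0 \<longleftrightarrow> v \<notin> Field R"
  by (auto simp: degree_def Field_def finite_Image)

lemma degree_eq_1_cases:
  assumes "degree R u = 1" "finite R"
  obtains p where "R `` {u} = {p}" "R\<inverse> `` {u} = {}" | p where "R `` {u} = {}" "R\<inverse> `` {u} = {p}"
proof -
  have fin: "finite (R `` {u})" "finite (R\<inverse> `` {u})" using assms(2) by (auto intro: finite_Image)
  from assms(1) consider "card (R `` {u}) = 1" "card (R\<inverse> `` {u}) = 0" | "card (R `` {u}) = 0" "card (R\<inverse> `` {u}) = 1"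
    unfolding degree_def by linarith
  then show thesis
    by cases (use fin that in \<open>auto simp: card_1_singleton_iff card_eq_0_iff\<close>)
qed

lemma degree_leaf:
  assumes "leaf_arc R u e"
  shows "degree R u = 1"
proof -
  from assms obtain p where p: "p \<noteq> u" "e \<in> {(u, p), (p, u)}" "e \<in> R" "u \<notin> Field (R - {e})"
    by (auto simp: leaf_arc_def)
  then have "(R `` {u} = {p} \<and> R\<inverse> `` {u} = {}) \<or> (R `` {u} = {} \<and> R\<inverse> `` {u} = {p})"
    by (auto simp: Field_def)
  then show ?thesis by (auto simp: degree_def)
qed

lemma arc_ok_block: "arc_ok j h h' \<Longrightarrow> fst h = fst h'"
  by (cases h; cases h') auto

lemma set_all_states: "set (all_states j) = (\<Union>k<j + 2. set (states k))"
  by (auto simp: all_states_def atLeast0LessThan simp del: upt_Suc)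

text \<open>Compatible states have the same bound \<open>k\<close>, so the pruning of the union of all targets restricts to the pruning of each
  of them.\<close>

lemma candidates_exclude:
  assumes B: "\<And>h h'. B h h' \<Longrightarrow> fst h = fst h'" and "k < j + 2"
    and s': "\<And>h :: state. s' (flag h) = exclude {h \<in> set (all_states j). \<not> supported B (all_states j) u s h} p s (flag h)"
  shows "candidates s' k =
    (candidates s k)(p := {h \<in> candidates s k p. \<exists>h' \<in> candidates s k u. B h' h})"
proof -
  have mem: "h \<in> set (states k)" if "h \<in> set (all_states j)" "fst h = k" for h
    using that fst_states unfolding set_all_states by blast
  have sub: "h \<in> set (all_states j)" if "h \<in> set (states k)" for h
    using that assms(2) unfolding set_all_states by blast
  have supp: "supported B (all_states j) u s h \<longleftrightarrow> (\<exists>h' \<in> candidates s k u. B h' h)"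
    if "h \<in> set (states k)" for h
  proof
    assume "supported B (all_states j) u s h"
    then obtain h' where h': "h' \<in> set (all_states j)" "B h' h" "s (flag h') u = 0"
      by (auto simp only: supported_def)
    then have "h' \<in> set (states k)" using mem B[OF h'(2)] fst_states[OF that] by simp
    then show "\<exists>h' \<in> candidates s k u. B h' h"
      using h' unfolding candidates_def by blast
  next
    assume "\<exists>h' \<in> candidates s k u. B h' h"
    then show "supported B (all_states j) u s h"
      using sub unfolding candidates_def supported_def by blast
  qed
  have val: "s' (flag (h :: state)) v = (if v = p \<and> h \<in> set (all_states j) \<and> \<not> supported B (all_states j) u s h
      then 1 else s (flag h) v)" for h v
    unfolding s'[of h] exclude_def by (simp add: inj_image_mem_iff[OF injI[OF iffD1[OF flag_inject]]])
  have "candidates s' k v =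
    ((candidates s k)(p := {h \<in> candidates s k p. \<exists>h' \<in> candidates s k u. B h' h})) v" for v
  proof (cases "v = p")
    case True
    have "h \<in> candidates s' k p \<longleftrightarrow> h \<in> candidates s k p \<and> (\<exists>h' \<in> candidates s k u. B h' h)" for h
      using supp[of h] sub[of h] unfolding candidates_def[of s'] candidates_def[of s k p] mem_Collect_eq val
      by (cases "h \<in> set (states k)") auto
    then show ?thesis unfolding True fun_upd_same by (intro set_eqI) (simp only: mem_Collect_eq)
  next
    case False
    then show ?thesis by (simp add: candidates_def val)
  qed
  then show ?thesis by (rule ext)
qed

section \<open>The run on a ditree\<close>

locale tree_input =
  fixes j :: nat and D :: "nat pair_pre_digraph" and es :: "(nat \<times> nat) list" and W :: nat
  assumes ditree: "ditree D" and es: "arc_list_of D es"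
    and W: "(card (pverts D) + 1) ^ 2 + j + 2 \<le> W"
begin

definition n :: nat where "n = card (pverts D)"

lemma verts: "pverts D = {..<n}" and distinct: "distinct es" and set_es: "set es = parcs D"
  using es by (auto simp: arc_list_of_def n_def)

lemma finite_arcs: "finite (parcs D)"
  using set_es by (metis List.finite_set)

lemma arc_lt: "(x, y) \<in> parcs D \<Longrightarrow> x < n \<and> y < n"
proof -
  interpret pair_fin_digraph D using ditree by (simp add: ditree_def)
  show "(x, y) \<in> parcs D \<Longrightarrow> x < n \<and> y < n"
    using in_arcsD1 in_arcsD2 verts by blast
qed

lemma asym: "(x, y) \<in> parcs D \<Longrightarrow> (y, x) \<notin> parcs D"
  using ditree by (auto simp: ditree_def)

lemma n_pos: "1 \<le> n"
  using ditree verts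
  by (cases n) (auto simp: ditree_def Digraph_Component.connected_def strongly_connected_def)

lemma card_arcs: "card (parcs D) \<le> n"
  using card_arc_forest_le[OF ditree_arc_forest[OF ditree], of "pverts D"] arc_lt
  by (force simp: verts Field_def)

lemma length_es: "length es = card (parcs D)"
  using distinct set_es by (metis distinct_card)

lemma W_bounds: "n * n + 2 * n + j + 3 \<le> W"
  using W by (simp add: n_def power2_eq_square)

lemma fit: "1 \<le> W" "Suc n \<le> W" "n + n \<le> W" "n * n \<le> W" "j + 2 \<le> W"
  using W_bounds by linarith+

lemma tally_bounds:
  assumes "R \<subseteq> parcs D"
  shows "card (R `` {v}) \<le> n" "\<Sum>(R `` {v}) \<le> n * n" "card (R\<inverse> `` {v}) \<le> n" "\<Sum>(R\<inverse> `` {v}) \<le> n * n"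
proof -
  have *: "card A \<le> n \<and> \<Sum>A \<le> n * n" if "A \<subseteq> {..<n}" for A
  proof
    show c: "card A \<le> n" using card_mono[OF _ that] by simp
    have "\<Sum>A \<le> card A * n" using that by (intro sum_bounded_above[of A id n, simplified]) (auto simp: subset_iff less_imp_le)
    also have "\<dots> \<le> n * n" using c by simp
    finally show "\<Sum>A \<le> n * n" .
  qed
  have "R `` {v} \<subseteq> {..<n}" "R\<inverse> `` {v} \<subseteq> {..<n}" using assms arc_lt by auto
  then show "card (R `` {v}) \<le> n" "\<Sum>(R `` {v}) \<le> n * n" "card (R\<inverse> `` {v}) \<le> n" "\<Sum>(R\<inverse> `` {v}) \<le> n * n"
    using * by blast+
qed

text \<open>The updated tables describe a set of arcs of \<open>D\<close> again, which bounds the new values without any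
  calculation.\<close>

lemma safe_tally:
  assumes "tallied R s" "R \<subseteq> parcs D" "tallied R' (step (tally b) s)" "R' \<subseteq> parcs D"
    "s ''x'' 0 < n" "s ''y'' 0 < n" "s ''x'' 0 \<noteq> s ''y'' 0"
  shows "safe W (tally b) s"
proof -
  have before: "s ''od'' v \<le> n" "s ''os'' v \<le> n * n" "s ''id'' v \<le> n" "s ''is'' v \<le> n * n" for v
    using assms(1) tally_bounds[OF assms(2)] by (simp_all add: tallied_def)
  have "step (tally b) s ''od'' v \<le> n" "step (tally b) s ''os'' v \<le> n * n"
    "step (tally b) s ''id'' v \<le> n" "step (tally b) s ''is'' v \<le> n * n" for v
    using assms(3) tally_bounds[OF assms(4)] by (simp_all add: tallied_def)
  from this(1)[of "s ''x'' 0"] this(2)[of "s ''x'' 0"] this(3)[of "s ''y'' 0"] this(4)[of "s ''y'' 0"]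
  have "apply_op b (s ''od'' (s ''x'' 0)) 1 \<le> n" "apply_op b (s ''os'' (s ''x'' 0)) (s ''y'' 0) \<le> n * n"
    "apply_op b (s ''id'' (s ''y'' 0)) 1 \<le> n" "apply_op b (s ''is'' (s ''y'' 0)) (s ''x'' 0) \<le> n * n"
    by (simp_all add: step_tally)
  with before[of "s ''x'' 0"] before[of "s ''y'' 0"] show ?thesis
    using assms(5-7) fit by (simp add: tally_def)
qed

subsection \<open>Loading\<close>

definition loaded :: "nat \<Rightarrow> store \<Rightarrow> bool" where
  "loaded i s \<longleftrightarrow> i \<le> length es \<and> s ''i'' 0 = i \<and> tallied (set (take i es)) s \<and>
     (\<forall>a. a \<notin> {''i'', ''x'', ''y'', ''od'', ''os'', ''id'', ''is''} \<longrightarrow> s a = input_store D es a)"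

lemma load_step:
  assumes "loaded i s" "i < length es"
  shows "safe W load_body s" "loaded (Suc i) (step load_body s)"
proof -
  obtain x y where xy: "es ! i = (x, y)" by (cases "es ! i")
  define s1 where "s1 = s(''x'' := (s ''x'')(0 := x), ''y'' := (s ''y'')(0 := y))"
  have arc: "(x, y) \<in> parcs D" using assms(2) xy set_es by (metis nth_mem)
  then have lt: "x < n" "y < n" "x \<noteq> y" using arc_lt asym by blast+
  have i: "s ''i'' 0 = i" using assms by (simp add: loaded_def)
  have frame: "s a = input_store D es a"
    if "a \<notin> {''i'', ''x'', ''y'', ''od'', ''os'', ''id'', ''is''}" for a
    using assms(1) that by (simp add: loaded_def)
  have "s ''tail'' i = x" "s ''head'' i = y"
    using frame[of "''tail''"] frame[of "''head''"] assms(2) xy by (auto simp: input_store_def)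
  note reads = i this
  have step1: "step (Assign ''y'' (Read ''head'' (Var ''i''))) (step (Assign ''x'' (Read ''tail'' (Var ''i''))) s) = s1"
    using reads by (simp add: s1_def)
  have sub: "set (take i es) \<subseteq> parcs D" "set (take (Suc i) es) \<subseteq> parcs D"
    using set_take_subset set_es by metis+
  have new: "set (take (Suc i) es) = insert (x, y) (set (take i es))"
    using assms(2) xy by (simp add: take_Suc_conv_app_nth)
  have notin: "(x, y) \<notin> set (take i es)"
  proof
    assume "(x, y) \<in> set (take i es)"
    then obtain i' where "i' < i" "es ! i' = (x, y)" by (auto simp: in_set_conv_nth)
    then show False using nth_eq_iff_index_eq[OF distinct, of i' i] assms(2) xy by simp
  qed
  have t1: "tallied (set (take i es)) s1"
    using assms(1) by (simp add: loaded_def tallied_def s1_def)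
  have t2: "tallied (set (take (Suc i) es)) (step (tally Plus) s1)"
    unfolding new using tallied_Plus[OF t1] notin by (simp add: s1_def)
  have st: "safe W (tally Plus) s1"
    using safe_tally[OF t1 sub(1) t2 sub(2)] lt by (simp add: s1_def)
  have i1: "step (tally Plus) s1 ''i'' 0 = i"
    using i by (simp add: step_tally s1_def)
  have i_le: "i \<le> n" using assms(2) length_es card_arcs by simp
  show "safe W load_body s"
    unfolding load_body_def seqs.simps safe.simps step1 using st lt i_le reads i1 fit
    by (simp add: s1_def)
  have body: "step load_body s =
      (step (tally Plus) s1)(''i'' := (step (tally Plus) s1 ''i'')(0 := Suc i))"
    unfolding load_body_def seqs.simps step.simps(1,3) step1 by (simp add: i1)
  show "loaded (Suc i) (step load_body s)"
    unfolding loaded_def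
  proof (intro conjI allI impI)
    show "tallied (set (take (Suc i) es)) (step load_body s)"
      using t2 unfolding body by (simp add: tallied_def)
    fix a assume "a \<notin> {''i'', ''x'', ''y'', ''od'', ''os'', ''id'', ''is''}"
    then show "step load_body s a = input_store D es a"
      using frame[of a] unfolding body step_tally by (simp add: s1_def)
  qed (use assms(2) body in auto)
qed

lemma runs_load:
  "runs W load (input_store D es) (load_cost * n + 6) (\<lambda>_. loaded (length es))"
proof -
  let ?I = "\<lambda>q s. \<exists>i. loaded i s \<and> q = load_cost * (length es - i)"
  let ?b = "Op Less (Var ''i'') (Var ''m'')"
  have m: "s ''m'' 0 = length es" if "loaded i s" for i s
    using that by (simp add: loaded_def input_store_def)
  have i: "s ''i'' 0 = i" "i \<le> length es" if "loaded i s" for i s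
    using that by (simp_all add: loaded_def)
  have len: "length es \<le> n" using length_es card_arcs by simp
  have "runs W (While ?b load_body) (input_store D es) (load_cost * length es + cost ?b + 1)
      (\<lambda>q s. ?I q s \<and> eval s ?b = 0)"
  proof (rule runs_While)
    show "?I (load_cost * length es) (input_store D es)"
      by (intro exI[of _ 0]) (auto simp: loaded_def tallied_def input_store_def fun_eq_iff)
    show "fits W s ?b" if "?I q s" for q s
    proof -
      from that obtain k where "loaded k s" by blast
      from m[OF this] i[OF this] len fit show ?thesis by (simp add: of_bool_def)
    qed
    show "\<exists>q1. q1 + cost ?b + 1 \<le> q \<and> runs W load_body s q1 ?I"
      if I: "?I q s" and b: "eval s ?b \<noteq> 0" for q s
    proof -
      obtain k where k: "loaded k s" "q = load_cost * (length es - k)" using I by blast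
      then have lt: "k < length es" using b m i by (auto split: if_splits)
      then have "length es - k = Suc (length es - Suc k)" by simp
      then have q: "q = load_cost + load_cost * (length es - Suc k)" using k(2) by simp
      have "runs W load_body s (q - 6) ?I"
        using load_step[OF k(1) lt]
        by (intro runs_safe[where q' = "load_cost * (length es - Suc k)"]) (auto simp: q load_cost_def)
      then show ?thesis by (intro exI[of _ "q - 6"]) (auto simp: q load_cost_def)
    qed
  qed
  then show ?thesis
    unfolding load_def
  proof (rule runs_mono[where r = 0])
    show "load_cost * length es + cost ?b + 1 + 0 \<le> load_cost * n + 6" using len by simp
    fix p s' assume "?I p s' \<and> eval s' ?b = 0"
    then obtain k where k: "loaded k s'" "eval s' ?b = 0" by auto
    then have "k = length es" using m[OF k(1)] i[OF k(1)] by (auto simp: of_bool_def split: if_splits)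
    then show "loaded (length es) s'" using k by simp
  qed
qed

subsection \<open>Stripping leaves\<close>

text \<open>Besides the consistency of the tables, the invariant says that the deleted arcs are accounted for by the
  candidates: the remaining arcs have a solution iff the ditree has a labeling.\<close>

definition stripping :: "(nat \<times> nat) set \<Rightarrow> store \<Rightarrow> bool" where
  "stripping R s \<longleftrightarrow> R \<subseteq> parcs D \<and> tallied R s \<and> s ''n'' 0 = n \<and> s ''out'' 0 = 0 \<and>
     (\<forall>(h :: state) v. s (flag h) v \<le> 1) \<and>
     (\<forall>k < j + 2. solvable {..<n} R (arc_ok j) (candidates s k) \<longleftrightarrow> dilambda j D \<le> k)"

lemma loaded_stripping:
  assumes "loaded (length es) s"
  shows "stripping (parcs D) s" "s ''v'' 0 = 0"
proof -
  have frame: "s a = input_store D es a"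
    if "a \<notin> {''i'', ''x'', ''y'', ''od'', ''os'', ''id'', ''is''}" for a
    using assms that by (simp add: loaded_def)
  have fl: "s (flag h) v = 0" for h :: state and v
    by (subst frame) (auto simp: input_store_def)
  then have "candidates s k = (\<lambda>_. set (states k))" for k
    by (auto simp: candidates_def)
  then have "solvable {..<n} (parcs D) (arc_ok j) (candidates s k) \<longleftrightarrow> dilambda j D \<le> k" for k
    using dilambda_le_iff[OF ditree, of j k] labeling_iff_solvable[OF ditree, of j k]
    by (simp only: verts)
  then show "stripping (parcs D) s"
    using assms fl unfolding stripping_def
    by (simp add: loaded_def set_es frame input_store_def n_def)
  show "s ''v'' 0 = 0" by (simp add: frame input_store_def)
qed

text \<open>Deleting the arc lowers the degrees of its two ends only. One end, the old leaf, becomes isolated, and the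
  other one is the next \<open>u\<close>; hence no other vertex turns into a leaf.\<close>

lemma cut_step:
  assumes inv: "stripping R s" and u: "s ''u'' 0 < n" and leaf: "eval s is_leaf \<noteq> 0"
  obtains R' where "safe W (cut j) s" "stripping R' (step (cut j) s)" "card R = Suc (card R')"
    "step (cut j) s ''u'' 0 < n" "step (cut j) s ''v'' = s ''v''"
    "\<And>w. w \<noteq> step (cut j) s ''u'' 0 \<Longrightarrow> degree R' w \<noteq> 1 \<or> (degree R w = 1 \<and> w \<noteq> s ''u'' 0)"
proof -
  let ?u = "s ''u'' 0"
  have R: "R \<subseteq> parcs D" "tallied R s" "s ''n'' 0 = n" "s ''out'' 0 = 0"
    "\<And>(h :: state) v. s (flag h) v \<le> 1"
    "\<And>k. k < j + 2 \<Longrightarrow> solvable {..<n} R (arc_ok j) (candidates s k) \<longleftrightarrow> dilambda j D \<le> k"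
    using inv by (auto simp: stripping_def)
  have fin: "finite R" using R(1) finite_arcs finite_subset by blast
  have deg: "degree R ?u = 1"
    using leaf R(2) by (auto simp: is_leaf_def tallied_def degree_def split: if_splits)
  obtain p a b where p: "\<Sum>(R `` {?u}) + \<Sum>(R\<inverse> `` {?u}) = p" "(a, b) \<in> R" "?u \<notin> Field (R - {(a, b)})"
    "p < n" "p \<noteq> ?u"
    and dir: "a = ?u \<and> b = p \<and> s ''od'' ?u \<noteq> 0 \<or> a = p \<and> b = ?u \<and> s ''od'' ?u = 0"
  proof (cases rule: degree_eq_1_cases[OF deg fin])
    case (1 p)
    then have arc: "(?u, p) \<in> R" by auto
    then have "p < n" "p \<noteq> ?u" using R(1) arc_lt asym by blast+
    moreover have "?u \<notin> Field (R - {(?u, p)})" using 1 by (auto simp: Field_def)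
    ultimately show ?thesis using that[of p ?u p] 1 arc R(2) by (simp add: tallied_def)
  next
    case (2 p)
    then have arc: "(p, ?u) \<in> R" by auto
    then have "p < n" "p \<noteq> ?u" using R(1) arc_lt asym by blast+
    moreover have "?u \<notin> Field (R - {(p, ?u)})" using 2 by (auto simp: Field_def)
    ultimately show ?thesis using that[of p p ?u] 2 arc R(2) by (simp add: tallied_def)
  qed
  define R' where "R' = R - {(a, b)}"
  \<comment> \<open>The two directions of the arc are treated together from here on.\<close>
  define B where "B = (if s ''od'' ?u \<noteq> 0 then arc_ok j else (\<lambda>h' h. arc_ok j h h'))"
  have block: "fst h = fst h'" if "B h h'" for h h'
    using that arc_ok_block[of j h h'] arc_ok_block[of j h' h] by (simp add: B_def split: if_splits)
  define s1 where "s1 = s(''p'' := (s ''p'')(0 := p))"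
  define H where "H = {h \<in> set (all_states j). \<not> supported B (all_states j) ?u s h}"
  define s2 where "s2 = (exclude H p s1)(''x'' := (s ''x'')(0 := a), ''y'' := (s ''y'')(0 := b))"
  define s3 where "s3 = step (tally Minus) s2"
  have sum: "s ''os'' ?u + s ''is'' ?u = p" using R(2) p(1) by (simp add: tallied_def)
  have prune: "step (prune B (all_states j) (all_states j)) s1 = exclude H p s1"
    using p(5) by (subst step_prune) (simp_all add: s1_def H_def supported_def)
  have up: "s1 ''u'' 0 = ?u" "s1 ''p'' 0 = p" "s1 ''od'' = s ''od''" by (simp_all add: s1_def)
  have step: "step (cut j) s = s3(''u'' := (s3 ''u'')(0 := p))"
  proof -
    have "step (cut j) s = step (Seq (tally Minus) (Assign ''u'' (Var ''p''))) s2"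
      using dir prune sum p(5)
      by (auto simp: cut_def B_def s1_def[symmetric] s2_def up split: if_splits)
        (simp_all add: s1_def)
    also have "\<dots> = s3(''u'' := (s3 ''u'')(0 := p))"
      by (simp add: s3_def[symmetric]) (simp add: s3_def s2_def s1_def step_tally)
    finally show ?thesis .
  qed
  have t2: "tallied R s2" using R(2) by (simp add: tallied_def s2_def s1_def)
  have t3: "tallied R' s3"
    using tallied_Minus[OF t2 fin] p(2) by (simp add: s3_def R'_def s2_def)
  have R'_sub: "R' \<subseteq> parcs D" using R(1) by (auto simp: R'_def)
  have ab: "a < n" "b < n" "a \<noteq> b" using p(4,5) u dir by auto
  have safe_t: "safe W (tally Minus) s2"
    using safe_tally[OF t2 R(1) t3[unfolded s3_def] R'_sub] ab by (simp add: s2_def)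
  have safe_p: "safe W (prune B (all_states j) (all_states j)) s1"
    using R(5) u p(4,5) fit by (intro safe_prune) (simp_all add: s1_def)
  have flags: "step (cut j) s (flag h) = exclude H p s (flag h)" for h :: state
    unfolding step s3_def step_tally s2_def by (auto simp: s1_def exclude_def fun_eq_iff)
  show thesis
  proof (rule that[of R'])
    have bounds: "s ''od'' ?u \<le> n" "s ''os'' ?u \<le> n * n" "s ''is'' ?u \<le> n * n"
      using R(2) tally_bounds[OF R(1)] by (simp_all add: tallied_def)
    have p3: "s3 ''p'' 0 = p" by (simp add: s3_def step_tally s2_def s1_def)
    show "safe W (cut j) s"
      using dir prune sum p(4,5) safe_p safe_t u bounds p3 ab fit
      by (auto simp: cut_def B_def s1_def[symmetric] up s2_def s3_def split: if_splits)
        (simp_all add: s1_def)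
    show "stripping R' (step (cut j) s)"
      unfolding stripping_def
    proof (intro conjI allI impI R'_sub)
      show "tallied R' (step (cut j) s)" using t3 by (simp add: step tallied_def)
      show "step (cut j) s ''n'' 0 = n" "step (cut j) s ''out'' 0 = 0"
        using R(3,4) by (simp_all add: step s3_def step_tally s2_def s1_def)
      show "step (cut j) s (flag h) v \<le> 1" for h :: state and v
        unfolding flags using R(5) by (simp add: exclude_def)
      fix k assume k: "k < j + 2"
      have cand: "candidates (step (cut j) s) k =
        (candidates s k)(p := {h \<in> candidates s k p. \<exists>h' \<in> candidates s k ?u. B h' h})"
        by (rule candidates_exclude[OF block k flags[unfolded H_def]])
      have "solvable {..<n} R (arc_ok j) (candidates s k) \<longleftrightarrow>
        solvable {..<n} R' (arc_ok j) (candidates (step (cut j) s) k)"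
        unfolding cand R'_def using p(2-5) u dir
        by (intro solvable_remove_leaf) (auto simp: B_def)
      then show "solvable {..<n} R' (arc_ok j) (candidates (step (cut j) s) k) \<longleftrightarrow> dilambda j D \<le> k"
        using R(6)[OF k] by simp
    qed
    show "card R = Suc (card R')" using p(2) fin unfolding R'_def by (metis card_Suc_Diff1)
    have u': "step (cut j) s ''u'' 0 = p" by (simp add: step)
    then show "step (cut j) s ''u'' 0 < n" using p(4) by simp
    show "step (cut j) s ''v'' = s ''v''" by (simp add: step s3_def step_tally s2_def s1_def)
    fix w assume w: "w \<noteq> step (cut j) s ''u'' 0"
    show "degree R' w \<noteq> 1 \<or> (degree R w = 1 \<and> w \<noteq> s ''u'' 0)"
    proof (cases "w = ?u")
      case True
      have "degree R' ?u = 0" using p(3) fin by (simp add: degree_eq_0_iff R'_def)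
      then show ?thesis using True by simp
    next
      case False
      then have "R' `` {w} = R `` {w}" "R'\<inverse> `` {w} = R\<inverse> `` {w}"
        using w u' dir by (auto simp: R'_def)
      then show ?thesis using False by (simp add: degree_def)
    qed
  qed
qed

lemma eval_is_leaf: "tallied R s \<Longrightarrow> eval s is_leaf \<noteq> 0 \<longleftrightarrow> degree R (s ''u'' 0) = 1"
  by (simp add: is_leaf_def tallied_def degree_def)

text \<open>Only the current vertex of the chain can be a leaf among the vertices up to \<open>v\<close>, and the chain ends at
  a vertex that is none; so when \<open>v\<close> has been dealt with, no vertex up to \<open>v\<close> is a leaf, and
  one pass suffices.\<close>

lemma runs_shave:
  assumes "stripping R s" "s ''v'' 0 = v" "s ''u'' 0 = v" "v < n" "\<And>w. w < v \<Longrightarrow> degree R w \<noteq> 1"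
  shows "runs W (While is_leaf (cut j)) s (cut_cost j * card R + cost is_leaf + 1)
    (\<lambda>q s'. \<exists>R'. q = cut_cost j * card R' \<and> stripping R' s' \<and> s' ''v'' 0 = v \<and>
      (\<forall>w \<le> v. degree R' w \<noteq> 1))"
proof -
  let ?I = "\<lambda>q s. \<exists>R. q = cut_cost j * card R \<and> stripping R s \<and> s ''v'' 0 = v \<and> s ''u'' 0 < n \<and>
    (\<forall>w \<le> v. w \<noteq> s ''u'' 0 \<longrightarrow> degree R w \<noteq> 1)"
  have "runs W (While is_leaf (cut j)) s (cut_cost j * card R + cost is_leaf + 1)
      (\<lambda>q s. ?I q s \<and> eval s is_leaf = 0)"
  proof (rule runs_While)
    show "?I (cut_cost j * card R) s"
      using assms by (intro exI[of _ R]) auto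
    show "fits W s is_leaf" if I: "?I q s" for q s
    proof -
      obtain R where R: "stripping R s" "s ''u'' 0 < n" using I by blast
      then have "tallied R s" "R \<subseteq> parcs D" by (simp_all add: stripping_def)
      then have "s ''od'' (s ''u'' 0) \<le> n" "s ''id'' (s ''u'' 0) \<le> n"
        using tally_bounds[of R] by (simp_all add: tallied_def)
      then show ?thesis using R(2) fit by (simp add: is_leaf_def of_bool_def)
    qed
    show "\<exists>q1. q1 + cost is_leaf + 1 \<le> q \<and> runs W (cut j) s q1 ?I"
      if I: "?I q s" and b: "eval s is_leaf \<noteq> 0" for q s
    proof -
      obtain R where R: "q = cut_cost j * card R" "stripping R s" "s ''v'' 0 = v" "s ''u'' 0 < n"
        "\<And>w. w \<le> v \<Longrightarrow> w \<noteq> s ''u'' 0 \<Longrightarrow> degree R w \<noteq> 1" using I by blast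
      from cut_step[OF R(2,4) b] obtain R' where R': "safe W (cut j) s"
        "stripping R' (step (cut j) s)" "card R = Suc (card R')"
        "step (cut j) s ''u'' 0 < n" "step (cut j) s ''v'' = s ''v''"
        "\<And>w. w \<noteq> step (cut j) s ''u'' 0 \<Longrightarrow> degree R' w \<noteq> 1 \<or> (degree R w = 1 \<and> w \<noteq> s ''u'' 0)"
        by blast
      have "runs W (cut j) s (time (cut j) + cut_cost j * card R') ?I"
      proof (rule runs_safe[OF R'(1) order_refl])
        show "?I (cut_cost j * card R') (step (cut j) s)"
          using R' R(3,5) by (intro exI[of _ R']) auto
      qed
      then show ?thesis
        by (intro exI[of _ "time (cut j) + cut_cost j * card R'"]) (simp add: R(1) R'(3) cut_cost_def)
    qed
  qed
  then show ?thesis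
  proof (rule runs_mono[where r = 0])
    fix q s' assume "?I q s' \<and> eval s' is_leaf = 0"
    then obtain R' where R': "q = cut_cost j * card R'" "stripping R' s'" "s' ''v'' 0 = v"
      "\<forall>w \<le> v. w \<noteq> s' ''u'' 0 \<longrightarrow> degree R' w \<noteq> 1" "eval s' is_leaf = 0" by blast
    then have "degree R' (s' ''u'' 0) \<noteq> 1" using eval_is_leaf[of R' s'] by (simp add: stripping_def)
    then show "\<exists>R'. q + 0 = cut_cost j * card R' \<and> stripping R' s' \<and> s' ''v'' 0 = v \<and>
      (\<forall>w \<le> v. degree R' w \<noteq> 1)"
      using R' by (intro exI[of _ R']) auto
  qed simp
qed

definition stripped :: "store \<Rightarrow> bool" where
  "stripped s \<longleftrightarrow> s ''n'' 0 = n \<and> (\<forall>(h :: state) v. s (flag h) v \<le> 1) \<and>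
     (\<forall>k < j + 2. (\<forall>v < n. candidates s k v \<noteq> {}) \<longleftrightarrow> dilambda j D \<le> k)"

lemma stripping_complete:
  assumes "stripping R s" "\<And>w. w < n \<Longrightarrow> degree R w \<noteq> 1"
  shows "stripped s" "s ''out'' 0 = 0"
proof -
  have R: "R \<subseteq> parcs D" using assms(1) by (simp add: stripping_def)
  have "R = {}"
  proof (rule ccontr)
    assume "R \<noteq> {}"
    then obtain u e where e: "leaf_arc R u e"
      using ditree_arc_forest[OF ditree] R unfolding arc_forest_def by metis
    then have "u < n" using R arc_lt by (auto simp: leaf_arc_def)
    then show False using assms(2) degree_leaf[OF e] by blast
  qed
  with assms(1) show "stripped s" "s ''out'' 0 = 0"
    unfolding stripping_def stripped_def by (simp_all add: solvable_empty Ball_def)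
qed

text \<open>The potential charges a fixed amount to every vertex still to be visited and to every remaining arc.\<close>

lemma runs_strip:
  assumes "stripping (parcs D) s" "s ''v'' 0 = 0"
  shows "runs W (strip j) s (strip_cost * n + cut_cost j * n + 6)
    (\<lambda>_ s'. stripped s' \<and> s' ''out'' 0 = 0)"
proof -
  let ?b = "Op Less (Var ''v'') (Var ''n'')"
  let ?c = "Seq (Assign ''u'' (Var ''v'')) (Seq (While is_leaf (cut j)) (Incr ''v''))"
  let ?I = "\<lambda>q s. \<exists>R v. q = strip_cost * (n - v) + cut_cost j * card R \<and> stripping R s \<and>
    s ''v'' 0 = v \<and> v \<le> n \<and> (\<forall>w < v. degree R w \<noteq> 1)"
  have "runs W (While ?b ?c) s (strip_cost * (n - 0) + cut_cost j * card (parcs D) + cost ?b + 1)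
      (\<lambda>q s. ?I q s \<and> eval s ?b = 0)"
  proof (rule runs_While)
    show "?I (strip_cost * (n - 0) + cut_cost j * card (parcs D)) s"
      using assms by (intro exI[of _ "parcs D"] exI[of _ 0]) simp
    show "fits W s ?b" if I: "?I q s" for q s
    proof -
      obtain R v where "stripping R s" "s ''v'' 0 = v" "v \<le> n" using I by blast
      then show ?thesis using fit by (simp add: stripping_def of_bool_def)
    qed
    show "\<exists>q1. q1 + cost ?b + 1 \<le> q \<and> runs W ?c s q1 ?I"
      if I: "?I q s" and b: "eval s ?b \<noteq> 0" for q s
    proof -
      obtain R v where R: "q = strip_cost * (n - v) + cut_cost j * card R" "stripping R s"
        "s ''v'' 0 = v" "v \<le> n" "\<And>w. w < v \<Longrightarrow> degree R w \<noteq> 1" using I by blast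
      have v: "v < n" using b R(2,3) by (simp add: stripping_def)
      then have "n - v = Suc (n - Suc v)" by simp
      then have q: "q = strip_cost + strip_cost * (n - Suc v) + cut_cost j * card R"
        using R(1) by simp
      let ?s = "s(''u'' := (s ''u'')(0 := v))"
      let ?rest = "strip_cost * (n - Suc v)"
      have s: "stripping R ?s" "?s ''v'' 0 = v" "?s ''u'' 0 = v"
        using R(2,3) by (simp_all add: stripping_def tallied_def candidates_def[abs_def])
      have "runs W ?c s (4 + (cost is_leaf + cut_cost j * card R + 7 + ?rest)) ?I"
      proof (rule runs_Seq)
        show "runs W (Assign ''u'' (Var ''v'')) s (4 + (cost is_leaf + cut_cost j * card R + 7 + ?rest))
          (\<lambda>q s'. q = cost is_leaf + cut_cost j * card R + 7 + ?rest \<and> s' = ?s)"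
        proof (rule runs_safe[where q' = "cost is_leaf + cut_cost j * card R + 7 + ?rest"])
          show "safe W (Assign ''u'' (Var ''v'')) s" using R(3) v fit by simp
        qed (use R(3) in simp_all)
        fix q1 s1 assume "q1 = cost is_leaf + cut_cost j * card R + 7 + ?rest \<and> s1 = ?s"
        then have q1: "q1 = cost is_leaf + cut_cost j * card R + 7 + ?rest" "s1 = ?s" by simp_all
        show "runs W (Seq (While is_leaf (cut j)) (Incr ''v'')) s1 q1 ?I"
        proof (rule runs_Seq)
          show "runs W (While is_leaf (cut j)) s1 q1
            (\<lambda>q s'. \<exists>R'. q = cut_cost j * card R' + (6 + ?rest) \<and> stripping R' s' \<and> s' ''v'' 0 = v \<and>
              (\<forall>w \<le> v. degree R' w \<noteq> 1))"
            unfolding q1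
            by (rule runs_mono[where r = "6 + ?rest", OF runs_shave[OF s v R(5)]]) auto
          fix q2 s2
          assume "\<exists>R'. q2 = cut_cost j * card R' + (6 + ?rest) \<and> stripping R' s2 \<and> s2 ''v'' 0 = v \<and>
              (\<forall>w \<le> v. degree R' w \<noteq> 1)"
          then obtain R' where R': "q2 = cut_cost j * card R' + (6 + ?rest)" "stripping R' s2"
            "s2 ''v'' 0 = v" "\<forall>w \<le> v. degree R' w \<noteq> 1" by blast
          show "runs W (Incr ''v'') s2 q2 ?I"
          proof (rule runs_safe[where q' = "?rest + cut_cost j * card R'"])
            show "safe W (Incr ''v'') s2" using R'(3) v fit by simp
            show "time (Incr ''v'') + (?rest + cut_cost j * card R') \<le> q2" by (simp add: R'(1))
            show "?I (?rest + cut_cost j * card R') (step (Incr ''v'') s2)"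
              using R'(2-4) v
              by (intro exI[of _ R'] exI[of _ "Suc v"])
                (simp add: stripping_def tallied_def candidates_def[abs_def] less_Suc_eq_le)
          qed
        qed
      qed
      then show ?thesis
        by (intro exI[of _ "4 + (cost is_leaf + cut_cost j * card R + 7 + ?rest)"])
          (simp add: q strip_cost_def)
    qed
  qed
  then show ?thesis
    unfolding strip_def
  proof (rule runs_mono[where r = 0])
    show "strip_cost * (n - 0) + cut_cost j * card (parcs D) + cost ?b + 1 + 0
      \<le> strip_cost * n + cut_cost j * n + 6" using card_arcs by simp
    fix q s' assume "?I q s' \<and> eval s' ?b = 0"
    then obtain R v where R: "stripping R s'" "s' ''v'' 0 = v" "v \<le> n"
      "\<forall>w < v. degree R w \<noteq> 1" "eval s' ?b = 0" by blast
    then have "v = n" by (simp add: stripping_def)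
    then show "stripped s' \<and> s' ''out'' 0 = 0" using stripping_complete[OF R(1)] R(4) by simp
  qed
qed

lemma candidates_frame:
  assumes "\<And>h :: state. a \<noteq> flag h"
  shows "candidates (s(a := f)) = candidates s"
proof -
  have "(s(a := f)) (flag h) = s (flag h)" for h :: state using assms[of h] by simp
  then show ?thesis by (intro ext) (simp only: candidates_def)
qed

lemma stripped_frame:
  assumes "stripped s" "a \<noteq> ''n''" "\<And>h :: state. a \<noteq> flag h"
  shows "stripped (s(a := f))"
proof -
  have "(s(a := f)) (flag h) = s (flag h)" for h :: state using assms(3)[of h] by simp
  then show ?thesis
    using assms(1,2) unfolding stripped_def candidates_frame[OF assms(3)] by simp
qed

lemma scan_test_step:
  assumes "stripped s" "s ''w'' 0 = w" "w < n" "k < j + 2"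
  shows "safe W (scan_test k) s" "stripped (step (scan_test k) s)"
    "step (scan_test k) s ''w'' 0 = Suc w"
    "step (scan_test k) s ''out'' 0 = (if candidates s k w = {} then Suc k else s ''out'' 0)"
    "candidates (step (scan_test k) s) = candidates s"
proof -
  let ?t = "all_nonzero (map (\<lambda>h. Read (flag h) (Var ''w'')) (states k))"
  have test: "eval s ?t = 0 \<longleftrightarrow> candidates s k w \<noteq> {}"
    using assms(2) by (auto simp: eval_all_nonzero candidates_def)
  have le: "s (flag h) v \<le> 1" for h :: state and v using assms(1) unfolding stripped_def by blast
  have le': "s (flag h) v \<le> W" for h :: state and v using le[of h v] fit(1) by simp
  have "fits W s ?t"
    using le le' assms(2,3) fit by (intro fits_all_nonzero) auto
  then show "safe W (scan_test k) s"
    using assms(2-4) fit by (simp add: scan_test_def)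
  show "stripped (step (scan_test k) s)"
    using assms(1) by (simp add: scan_test_def stripped_frame)
  show "step (scan_test k) s ''w'' 0 = Suc w"
    using assms(2) by (simp add: scan_test_def)
  show "step (scan_test k) s ''out'' 0 = (if candidates s k w = {} then Suc k else s ''out'' 0)"
    using test by (simp add: scan_test_def)
  show "candidates (step (scan_test k) s) = candidates s"
    by (simp add: scan_test_def candidates_frame)
qed

lemma runs_scan:
  assumes "stripped s" "s ''out'' 0 = min (dilambda j D) k" "k < j + 2"
  shows "runs W (scan k) s ((time (scan_test k) + 15) * n)
    (\<lambda>_ s'. stripped s' \<and> s' ''out'' 0 = min (dilambda j D) (Suc k))"
proof -
  let ?b = "Op Less (Var ''w'') (Var ''n'')"
  let ?C = "time (scan_test k) + 6"
  define out where "out s w = (if \<exists>v < w. candidates s k v = {} then Suc k else min (dilambda j D) k)"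
    for s w
  let ?I = "\<lambda>q s. \<exists>w. q = ?C * (n - w) \<and> stripped s \<and> s ''w'' 0 = w \<and> w \<le> n \<and> s ''out'' 0 = out s w"
  let ?s = "s(''w'' := (s ''w'')(0 := 0))"
  have "runs W (While ?b (scan_test k)) ?s (?C * (n - 0) + cost ?b + 1)
      (\<lambda>q s. ?I q s \<and> eval s ?b = 0)"
  proof (rule runs_While)
    show "?I (?C * (n - 0)) ?s"
      using assms(1,2) by (intro exI[of _ 0]) (simp add: stripped_frame out_def)
    show "fits W s ?b" if I: "?I q s" for q s
    proof -
      obtain w where "stripped s" "s ''w'' 0 = w" "w \<le> n" using I by blast
      then show ?thesis using fit by (simp add: stripped_def of_bool_def)
    qed
    show "\<exists>q1. q1 + cost ?b + 1 \<le> q \<and> runs W (scan_test k) s q1 ?I"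
      if I: "?I q s" and b: "eval s ?b \<noteq> 0" for q s
    proof -
      obtain w where w: "q = ?C * (n - w)" "stripped s" "s ''w'' 0 = w" "w \<le> n"
        "s ''out'' 0 = out s w" using I by blast
      have lt: "w < n" using b w(2,3) by (simp add: stripped_def)
      then have "n - w = Suc (n - Suc w)" by simp
      then have q: "q = ?C + ?C * (n - Suc w)" using w(1) by simp
      note st = scan_test_step[OF w(2,3) lt assms(3)]
      have "runs W (scan_test k) s (time (scan_test k) + ?C * (n - Suc w)) ?I"
      proof (rule runs_safe[OF st(1) order_refl])
        show "?I (?C * (n - Suc w)) (step (scan_test k) s)"
        proof (intro exI[of _ "Suc w"] conjI)
          show "step (scan_test k) s ''out'' 0 = out (step (scan_test k) s) (Suc w)"
            unfolding out_def st(4,5) w(5) by (auto simp: less_Suc_eq)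
          show "Suc w \<le> n" using lt by simp
        qed (use st(2,3) in simp_all)
      qed
      then show ?thesis
        by (intro exI[of _ "time (scan_test k) + ?C * (n - Suc w)"]) (simp add: q)
    qed
  qed
  then have loop: "runs W (While ?b (scan_test k)) ?s (?C * n + 6)
      (\<lambda>_ s'. stripped s' \<and> s' ''out'' 0 = min (dilambda j D) (Suc k))"
  proof (rule runs_mono[where r = 0])
    fix q s' assume "?I q s' \<and> eval s' ?b = 0"
    then obtain w where w: "stripped s'" "s' ''w'' 0 = w" "w \<le> n"
        "s' ''out'' 0 = out s' w" "eval s' ?b = 0" by blast
    then have "w = n" by (simp add: stripped_def)
    moreover have "(\<forall>v < n. candidates s' k v \<noteq> {}) \<longleftrightarrow> dilambda j D \<le> k"
      using w(1) assms(3) by (simp add: stripped_def)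
    ultimately have "s' ''out'' 0 = (if dilambda j D \<le> k then min (dilambda j D) k else Suc k)"
      using w(4) unfolding out_def by auto
    then show "stripped s' \<and> s' ''out'' 0 = min (dilambda j D) (Suc k)" using w(1) by simp
  qed simp
  have "runs W (scan k) s (3 + (?C * n + 6))
      (\<lambda>_ s'. stripped s' \<and> s' ''out'' 0 = min (dilambda j D) (Suc k))"
    unfolding scan_def
  proof (rule runs_Seq_add)
    show "runs W (Assign ''w'' (Const 0)) s 3 (\<lambda>_ s'. s' = ?s)"
      using fit by (intro runs_safe[where q' = 0]) simp_all
  qed (use loop in simp)
  moreover have "3 + (?C * n + 6) \<le> (time (scan_test k) + 15) * n"
    using n_pos by (simp add: algebra_simps)
  ultimately show ?thesis by (auto elim!: runs_mono[where r = 0])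
qed

lemma runs_scans:
  assumes "stripped s" "s ''out'' 0 = 0" "k \<le> j + 2"
  shows "runs W (scans k) s (scans_cost k * n)
    (\<lambda>_ s'. stripped s' \<and> s' ''out'' 0 = min (dilambda j D) k)"
  using assms(3)
proof (induction k)
  case 0
  show ?case using assms(1,2) n_pos by (intro runs_safe[where q' = 0]) (simp_all add: scans_cost_def)
next
  case (Suc k)
  have "runs W (scans (Suc k)) s (scans_cost k * n + (time (scan_test k) + 15) * n)
    (\<lambda>_ s'. stripped s' \<and> s' ''out'' 0 = min (dilambda j D) (Suc k))"
    unfolding scans.simps
  proof (rule runs_Seq_add[OF Suc.IH])
    fix s' assume "stripped s' \<and> s' ''out'' 0 = min (dilambda j D) k"
    then show "runs W (scan k) s' ((time (scan_test k) + 15) * n)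
      (\<lambda>_ s'. stripped s' \<and> s' ''out'' 0 = min (dilambda j D) (Suc k))"
      using Suc.prems by (intro runs_scan) simp_all
  qed (use Suc.prems in simp)
  then show ?case by (simp add: scans_cost_def algebra_simps)
qed

lemma dilambda_bound: "dilambda j D \<le> j + 2"
  using labeling_exists[OF ditree] dilambda_le_iff[OF ditree] by blast

lemma runs_lambda_program:
  "runs W (lambda_program j) (input_store D es)
    ((load_cost + strip_cost + cut_cost j + scans_cost (j + 2) + 12) * n)
    (\<lambda>_ s'. s' ''out'' 0 = dilambda j D)"
proof -
  have "runs W (lambda_program j) (input_store D es)
    (load_cost * n + 6 + (strip_cost * n + cut_cost j * n + 6 + scans_cost (j + 2) * n))
    (\<lambda>_ s'. stripped s' \<and> s' ''out'' 0 = min (dilambda j D) (j + 2))"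
    unfolding lambda_program_def
  proof (intro runs_Seq_add)
    show "runs W load (input_store D es) (load_cost * n + 6) (\<lambda>_. loaded (length es))"
      by (rule runs_load)
    show "runs W (strip j) s (strip_cost * n + cut_cost j * n + 6) (\<lambda>_ s'. stripped s' \<and> s' ''out'' 0 = 0)"
      if "loaded (length es) s" for s
      using runs_strip loaded_stripping[OF that] by blast
    show "runs W (scans (j + 2)) s (scans_cost (j + 2) * n)
      (\<lambda>_ s'. stripped s' \<and> s' ''out'' 0 = min (dilambda j D) (j + 2))"
      if "stripped s \<and> s ''out'' 0 = 0" for s
      using runs_scans that by blast
  qed
  then show ?thesis
    by (rule runs_mono[where r = 0]) (use n_pos dilambda_bound in \<open>simp_all add: algebra_simps\<close>)
qed

end

text \<open>The arithmetic needs words of about \<open>(n + 1)\<^sup>2 + j\<close>; a power of \<open>n + 1 \<ge> 2\<close> with an exponent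
  that depends on \<open>j\<close> only is large enough.\<close>

lemma word_size: "(n + 1) ^ 2 + j + 2 \<le> (n + 1) ^ (j + 4)" if "1 \<le> n" for n :: nat
proof -
  have "j + 3 \<le> 2 ^ (j + 2)" using less_exp[of "j + 2"] by linarith
  also have "\<dots> \<le> (n + 1) ^ (j + 2)" using that by (intro power_mono) simp_all
  finally have pow: "j + 3 \<le> (n + 1) ^ (j + 2)" .
  have "j + 2 \<le> (n + 1) ^ 2 * (j + 2)"
    using mult_le_mono1[of 1 "(n + 1) ^ 2" "j + 2"] by (simp only: mult_1) simp
  then have "(n + 1) ^ 2 + (j + 2) \<le> (n + 1) ^ 2 + (n + 1) ^ 2 * (j + 2)" by (rule add_left_mono)
  also have "\<dots> = (n + 1) ^ 2 * (j + 3)" by (simp add: algebra_simps)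
  also have "\<dots> \<le> (n + 1) ^ 2 * (n + 1) ^ (j + 2)" using pow by (rule mult_le_mono2)
  also have "\<dots> = (n + 1) ^ (j + 4)"
  proof -
    have "j + 4 = 2 + (j + 2)" by simp
    then show ?thesis by (simp only: power_add)
  qed
  finally show ?thesis by (simp only: add.assoc)
qed

lemma tree_input_instance:
  assumes "ditree D" "arc_list_of D es"
  shows "tree_input j D es ((card (pverts D) + 1) ^ (j + 4))"
proof (rule tree_input.intro)
  have "1 \<le> card (pverts D)"
    using assms(1)
    by (simp add: ditree_def pair_fin_digraph_def pair_fin_digraph_axioms_def Suc_le_eq card_gt_0_iff
        Digraph_Component.connected_def strongly_connected_def)
  then show "(card (pverts D) + 1)\<^sup>2 + j + 2 \<le> (card (pverts D) + 1) ^ (j + 4)"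
    by (rule word_size)
qed (use assms in simp_all)

lemma computes_dilambda: "computes_in_linear_time (lambda_program j) ditree (dilambda j)"
  unfolding computes_in_linear_time_def
proof (rule exI, rule exI, intro allI impI, elim conjE)
  fix D es assume D: "ditree D" "arc_list_of D es"
  interpret tree_input j D es "(card (pverts D) + 1) ^ (j + 4)"
    by (rule tree_input_instance[OF D])
  from runs_lambda_program
  show "\<exists>t s'. exec ((card (pverts D) + 1) ^ (j + 4)) (lambda_program j) (input_store D es) t s' \<and>
    t \<le> (load_cost + strip_cost + cut_cost j + scans_cost (j + 2) + 12) * card (pverts D) \<and>
    s' ''out'' 0 = dilambda j D"
    unfolding runs_def n_def using le_trans[OF le_add1] by blast
qed

lemma decides_dilambda_eq:
  "decides_in_linear_time
    (Seq (lambda_program j) (Assign ''out'' (Op Equal (Var ''out'') (Const (j + 1)))))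
    ditree (\<lambda>D. dilambda j D = j + 1)"
  unfolding decides_in_linear_time_def computes_in_linear_time_def
proof (rule exI, rule exI, intro allI impI, elim conjE)
  fix D es assume D: "ditree D" "arc_list_of D es"
  let ?W = "(card (pverts D) + 1) ^ (j + 4)"
  let ?c = "Assign ''out'' (Op Equal (Var ''out'') (Const (j + 1)))"
  let ?C = "load_cost + strip_cost + cut_cost j + scans_cost (j + 2) + 12"
  interpret tree_input j D es ?W by (rule tree_input_instance[OF D])
  have "runs ?W (Seq (lambda_program j) ?c) (input_store D es) (?C * n + 6)
    (\<lambda>_ s'. s' ''out'' 0 = of_bool (dilambda j D = j + 1))"
  proof (rule runs_Seq_add[OF runs_lambda_program])
    fix s :: store assume s: "s ''out'' 0 = dilambda j D"
    show "runs ?W ?c s 6 (\<lambda>_ s'. s' ''out'' 0 = of_bool (dilambda j D = j + 1))"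
      using s dilambda_bound fit by (intro runs_safe[where q' = 0]) (simp_all add: of_bool_def)
  qed
  then obtain t s' where ts: "exec ?W (Seq (lambda_program j) ?c) (input_store D es) t s'"
    "t \<le> ?C * n + 6" "s' ''out'' 0 = of_bool (dilambda j D = j + 1)"
    unfolding runs_def using le_trans[OF le_add1] by blast
  have "?C * n + 6 \<le> (?C + 6) * n" using n_pos by (simp add: algebra_simps)
  with ts show "\<exists>t s'. exec ?W (Seq (lambda_program j) ?c) (input_store D es) t s' \<and>
      t \<le> (?C + 6) * card (pverts D) \<and> s' ''out'' 0 = of_bool (dilambda j D = j + 1)"
    unfolding n_def[symmetric] by (intro exI[of _ t] exI[of _ s'] conjI) simp_all
qed

theorem mainTheorem6:
  fixes j :: nat
  assumes "1 \<le> j"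
  shows "(\<exists>P. decides_in_linear_time P ditree (\<lambda>T. dilambda j T = j + 1)) \<and>
         (\<exists>P. computes_in_linear_time P
                (\<lambda>T. ditree T \<and> longest_dipath_length T 3) (\<lambda>T. dilambda j T))"
proof (intro conjI exI)
  show "decides_in_linear_time
      (Seq (lambda_program j) (Assign ''out'' (Op Equal (Var ''out'') (Const (j + 1)))))
      ditree (\<lambda>T. dilambda j T = j + 1)"
    by (rule decides_dilambda_eq)
  show "computes_in_linear_time (lambda_program j)
      (\<lambda>T. ditree T \<and> longest_dipath_length T 3) (\<lambda>T. dilambda j T)"
    using computes_dilambda[of j] unfolding computes_in_linear_time_def by blast
qed

end
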